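(* Let $G$ be a finite $2$-group. Then $G$ is a $\mathrm{CM}$-group if and only if $G$ is a GVZ-group and a rational group.
   Context: $\mathrm{Irr}(G)$ denotes the set of irreducible complex characters of $G$. A finite group $G$ is a $\mathrm{CM}$-group (that is, a $\mathrm{CM}_1$-group) if for every normal subgroup $N$ of $G$ there is at most one character $\chi \in \mathrm{Irr}(G)$ with $\ker(\chi) = N$. For $\chi \in \mathrm{Irr}(G)$, the center of $\chi$ is $Z(\chi) = \{ g \in G \mid |\chi(g)| = \chi(1) \}$. A finite group $G$ is a GVZ-group if $\chi(1) = |G:Z(\chi)|^{1/2}$ for every $\chi \in \mathrm{Irr}(G)$. A finite group $G$ is rational if every $\chi \in \mathrm{Irr}(G)$ takes only rational values. *)

theory Defs
  imports Complex_Main "HOL-Algebra.Coset" "Jordan_Normal_Form.VS_Connect"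
begin

text \<open>\<open>GL(n, \<complex>)\<close> is the group of units of the ring of complex \<open>n \<times> n\<close> matrices.\<close>

definition is_representation ::
    "('a, 'b) monoid_scheme \<Rightarrow> nat \<Rightarrow> ('a \<Rightarrow> complex mat) \<Rightarrow> bool" where
  "is_representation G n \<rho> \<longleftrightarrow> \<rho> \<in> hom G (units_of (ring_mat TYPE(complex) n ()))"

definition is_irreducible_representation ::
    "('a, 'b) monoid_scheme \<Rightarrow> nat \<Rightarrow> ('a \<Rightarrow> complex mat) \<Rightarrow> bool" where
  "is_irreducible_representation G n \<rho> \<longleftrightarrow>
     is_representation G n \<rho> \<and> n > 0 \<and>
     (\<forall>W. VectorSpace.subspace class_ring W (module_vec TYPE(complex) n) \<longrightarrow>
        (\<forall>g\<in>carrier G. \<forall>w\<in>W. \<rho> g *\<^sub>v w \<in> W) \<longrightarrow>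
        W = {0\<^sub>v n} \<or> W = carrier_vec n)"

definition mat_trace :: "'c::comm_monoid_add mat \<Rightarrow> 'c" where
  "mat_trace A = (\<Sum>i<dim_row A. A $$ (i, i))"

text \<open>A character is a function on the carrier of \<open>G\<close>; restricting it (it is
  \<^const>\<open>undefined\<close> elsewhere) makes equality of characters equality on \<open>G\<close>.\<close>

definition character_of ::
    "('a, 'b) monoid_scheme \<Rightarrow> ('a \<Rightarrow> complex mat) \<Rightarrow> 'a \<Rightarrow> complex" where
  "character_of G \<rho> = (\<lambda>g\<in>carrier G. mat_trace (\<rho> g))"

definition Irr :: "('a, 'b) monoid_scheme \<Rightarrow> ('a \<Rightarrow> complex) set" where
  "Irr G = {character_of G \<rho> | n \<rho>. is_irreducible_representation G n \<rho>}"

definition char_kernel :: "('a, 'b) monoid_scheme \<Rightarrow> ('a \<Rightarrow> complex) \<Rightarrow> 'a set" where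
  "char_kernel G \<chi> = {g \<in> carrier G. \<chi> g = \<chi> \<one>\<^bsub>G\<^esub>}"

definition char_center :: "('a, 'b) monoid_scheme \<Rightarrow> ('a \<Rightarrow> complex) \<Rightarrow> 'a set" where
  "char_center G \<chi> = {g \<in> carrier G. complex_of_real (cmod (\<chi> g)) = \<chi> \<one>\<^bsub>G\<^esub>}"

definition CM_group :: "('a, 'b) monoid_scheme \<Rightarrow> bool" where
  "CM_group G \<longleftrightarrow>
     (\<forall>N. N \<lhd> G \<longrightarrow> (\<exists>\<^sub>\<le>\<^sub>1 \<chi>. \<chi> \<in> Irr G \<and> char_kernel G \<chi> = N))"

definition GVZ_group :: "('a, 'b) monoid_scheme \<Rightarrow> bool" where
  "GVZ_group G \<longleftrightarrow>
     (\<forall>\<chi>\<in>Irr G. \<chi> \<one>\<^bsub>G\<^esub> =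
        complex_of_real (sqrt (real (card (rcosets\<^bsub>G\<^esub> (char_center G \<chi>))))))"

definition rational_group :: "('a, 'b) monoid_scheme \<Rightarrow> bool" where
  "rational_group G \<longleftrightarrow> (\<forall>\<chi>\<in>Irr G. \<forall>g\<in>carrier G. \<chi> g \<in> \<rat>)"

end

theory Submission
  imports Defs
    "Jordan_Normal_Form.Spectral_Radius"
    "HOL-Algebra.Multiplicative_Group"
    "HOL-Algebra.Group_Action"
    "HOL-Computational_Algebra.Primes"
begin

text \<open>The center \<open>Z(\<chi>)\<close> consists of the elements acting by scalars, so by Schur's lemma it is determined
  by \<open>ker \<chi>\<close>. If \<open>\<chi>(1)\<^sup>2 = |G : Z(\<chi>)|\<close>, then \<open>\<Sum> |\<chi>(g)|\<^sup>2 = |G|\<close> makes \<open>\<chi>\<close> vanish off \<open>Z(\<chi>)\<close>, and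
  rationality leaves only the values \<open>\<plusminus>\<chi>(1)\<close> on \<open>Z(\<chi>)\<close>; hence \<open>\<chi>\<close> is determined by its kernel.
  Conversely, in a CM-group \<open>\<chi>\<close> agrees with its complex conjugate, which has the same kernel, so
  \<open>Z(\<chi>)\<close> acts by \<open>\<plusminus>1\<close>. For a 2-group the restriction of \<open>\<chi>\<close> to \<open>Z(\<chi>)\<close>, extended by zero, is a
  class function orthogonal to every other irreducible character, hence a multiple of \<open>\<chi>\<close>; so \<open>\<chi>\<close>
  vanishes off \<open>Z(\<chi>)\<close>, and the norm of \<open>\<chi>\<close> gives \<open>\<chi>(1)\<^sup>2 = |G : Z(\<chi>)|\<close>.\<close>

section \<open>Complex matrices of finite order\<close>

text \<open>The condition |\<chi>(g)| = \<chi>(1) speaks of a trace, while Schur's lemma and the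
  argument with signs need the matrix itself. The bridge is that \<open>\<rho> g\<close> has finite
  order: its eigenvalues are roots of unity, a trace of maximal modulus makes them all equal, and in
  characteristic 0 a matrix of finite order with a single eigenvalue is scalar. The power of 2
  enters through a quotient. A normal subgroup properly containing ker \<chi> has nontrivial image
  in the 2-group G / ker \<chi>, so this image meets the center Z(\<chi>) / ker \<chi> nontrivially.
  In a CM-group such a subgroup therefore contains an element on which \<rho> is the scalar -1. An
  irreducible \<sigma> that repeats the signs of \<rho> on Z(\<chi>) thus cannot have a kernel
  larger than ker \<chi>, and the CM property makes the two characters equal.\<close>

lemma mat_trace_mult_comm:
  fixes A B :: "'c :: comm_semiring_0 mat"
  assumes "A \<in> carrier_mat n m" "B \<in> carrier_mat m n"
  shows "mat_trace (A * B) = mat_trace (B * A)"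
proof -
  have "mat_trace (A * B) = (\<Sum>i<n. \<Sum>k<m. A $$ (i, k) * B $$ (k, i))"
    using assms by (auto simp: mat_trace_def scalar_prod_def lessThan_atLeast0)
  also have "\<dots> = (\<Sum>k<m. \<Sum>i<n. B $$ (k, i) * A $$ (i, k))"
    by (subst sum.swap) (simp add: mult.commute)
  also have "\<dots> = mat_trace (B * A)"
    using assms by (auto simp: mat_trace_def scalar_prod_def lessThan_atLeast0)
  finally show ?thesis .
qed

lemma mat_trace_similar:
  fixes A :: "'c :: comm_semiring_1 mat"
  assumes "A \<in> carrier_mat n n" "similar_mat_wit A B P Q"
  shows "mat_trace A = mat_trace B"
proof -
  note w = similar_mat_witD2[OF assms]
  have "mat_trace A = mat_trace ((P * B) * Q)" using w by simp
  also have "\<dots> = mat_trace (Q * (P * B))"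
    using w by (intro mat_trace_mult_comm) auto
  also have "Q * (P * B) = (Q * P) * B" using w by (intro assoc_mult_mat[symmetric]) auto
  also have "\<dots> = B" using w by simp
  finally show ?thesis .
qed

lemma mat_trace_smult_one: "mat_trace (c \<cdot>\<^sub>m 1\<^sub>m n :: 'c :: comm_semiring_1 mat) = of_nat n * c"
  by (simp add: mat_trace_def)

lemma upper_triangular_mult:
  fixes A B :: "'c :: semiring_0 mat"
  assumes A: "A \<in> carrier_mat n n" "upper_triangular A"
    and B: "B \<in> carrier_mat n n" "upper_triangular B"
  shows "upper_triangular (A * B)"
    and "i < n \<Longrightarrow> (A * B) $$ (i, i) = A $$ (i, i) * B $$ (i, i)"
proof -
  \<comment> \<open>For k < i the factor from \<open>A\<close> lies below the diagonal. Otherwise j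
    \<le> i \<le> k, and as the three indices are not all equal, j < k, so the factor from
    \<open>B\<close> lies below it.\<close>
  have z: "A $$ (i, k) * B $$ (k, j) = 0" if "i < n" "k < n" "j \<le> i" "k \<noteq> i \<or> j \<noteq> i" for i j k
  proof (cases "k < i")
    case True
    then show ?thesis using A that by (auto dest: upper_triangularD)
  next
    case False
    then have "j < k" using that by auto
    then show ?thesis using B that by (auto dest: upper_triangularD)
  qed
  show "upper_triangular (A * B)"
  proof (rule upper_triangularI)
    fix i j assume "j < i" "i < dim_row (A * B)"
    then show "(A * B) $$ (i, j) = 0"
      using A B z by (auto simp: scalar_prod_def intro!: sum.neutral)
  qed
  show "(A * B) $$ (i, i) = A $$ (i, i) * B $$ (i, i)" if i: "i < n"
  proof -
    have "(A * B) $$ (i, i) = (\<Sum>k<n. A $$ (i, k) * B $$ (k, i))"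
      using A B i by (auto simp: scalar_prod_def lessThan_atLeast0)
    also have "\<dots> = (\<Sum>k<n. if k = i then A $$ (i, i) * B $$ (i, i) else 0)"
      using z i by (intro sum.cong) auto
    finally show ?thesis using i by simp
  qed
qed

lemma upper_triangular_pow:
  fixes A :: "'c :: semiring_1 mat"
  assumes A: "A \<in> carrier_mat n n" "upper_triangular A"
  shows "upper_triangular (A ^\<^sub>m k) \<and> (\<forall>i<n. (A ^\<^sub>m k) $$ (i, i) = A $$ (i, i) ^ k)"
proof (induction k)
  case 0
  then show ?case using A by auto
next
  case (Suc k)
  have C: "A ^\<^sub>m k \<in> carrier_mat n n" using A by simp
  show ?case
    using upper_triangular_mult[OF C _ A] Suc by (simp add: power_commutes)
qed



lemma mult_mat_vec_unit:
  assumes "(A :: 'c :: semiring_1 mat) \<in> carrier_mat n m" "j < m"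
  shows "A *\<^sub>v unit_vec m j = col A j"
  using assms by (intro eq_vecI) auto

text \<open>This is the power of a Jordan block of size two, with the derivative of the power
  function as coefficient of \<open>w\<close>. The exponent \<open>Suc k\<close> avoids a truncated
  k - 1. The lemma serves to exclude such blocks in matrices of finite order.\<close>

lemma pow_mat_generalized_eigenvector:
  fixes A :: "'c :: field mat"
  assumes A: "A \<in> carrier_mat n n" and v: "v \<in> carrier_vec n" and w: "w \<in> carrier_vec n"
    and Av: "A *\<^sub>v v = c \<cdot>\<^sub>v v + w" and Aw: "A *\<^sub>v w = c \<cdot>\<^sub>v w"
  shows "(A ^\<^sub>m Suc k) *\<^sub>v v = c ^ Suc k \<cdot>\<^sub>v v + (of_nat (Suc k) * c ^ k) \<cdot>\<^sub>v w"
proof (induction k)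
  case 0
  then show ?case using A Av by simp
next
  case (Suc k)
  have P: "A ^\<^sub>m j \<in> carrier_mat n n" for j using A by simp
  have Pw: "(A ^\<^sub>m j) *\<^sub>v w = c ^ j \<cdot>\<^sub>v w" for j
  proof (induction j)
    case 0
    then show ?case using A w by simp
  next
    case (Suc j)
    have "(A ^\<^sub>m Suc j) *\<^sub>v w = (A ^\<^sub>m j) *\<^sub>v (c \<cdot>\<^sub>v w)"
      using A w Aw by (simp add: assoc_mult_mat_vec[OF P A w])
    also have "\<dots> = c \<cdot>\<^sub>v (c ^ j \<cdot>\<^sub>v w)"
      using Suc mult_mat_vec[OF P w] by simp
    finally show ?case by (simp add: smult_smult_assoc)
  qed
  have "(A ^\<^sub>m Suc (Suc k)) *\<^sub>v v = (A ^\<^sub>m Suc k) *\<^sub>v (c \<cdot>\<^sub>v v + w)"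
    using assoc_mult_mat_vec[OF P A v, of "Suc k"] Av by (simp del: pow_mat.simps(2) add: pow_mat.simps(2)[of A "Suc k"])
  also have "\<dots> = c \<cdot>\<^sub>v ((A ^\<^sub>m Suc k) *\<^sub>v v) + (A ^\<^sub>m Suc k) *\<^sub>v w"
    using v w by (subst mult_add_distrib_mat_vec[OF P]) (auto simp: mult_mat_vec[OF P v] simp del: pow_mat.simps(2))
  finally show ?case
    unfolding Suc Pw using v w
    by (intro eq_vecI) (auto simp: algebra_simps)
qed

text \<open>Induction over the columns: the earlier columns are already \<open>c\<close> times unit
  vectors, and the defect \<open>w\<close> of column j lives only in the rows above j, so
  \<open>A\<close> multiplies \<open>w\<close> by \<open>c\<close>. Comparing
  \<open>A ^\<^sub>m m\<close> with the identity on the j-th unit vector gives m c^(m-1) w = 0, and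
  characteristic 0 yields w = 0.\<close>

lemma upper_triangular_finite_order_scalar:
  fixes A :: "'c :: field_char_0 mat"
  assumes A: "A \<in> carrier_mat n n" "upper_triangular A"
    and m: "A ^\<^sub>m m = 1\<^sub>m n" "m > 0"
    and d: "\<And>i. i < n \<Longrightarrow> A $$ (i, i) = c"
  shows "A = c \<cdot>\<^sub>m 1\<^sub>m n"
proof -
  \<comment> \<open>The index j only witnesses n > 0; for n = 0 the value of \<open>c\<close> is
    arbitrary.\<close>
  have pw: "c ^ m = 1" if "j < n" for j
    using upper_triangular_pow[OF A, of m] m d that by (metis index_one_mat(1))
  have col: "col A j = c \<cdot>\<^sub>v unit_vec n j" if "j < n" for j
    using that
  proof (induction j rule: less_induct)
    case (less j)
    define w where "w = col A j - c \<cdot>\<^sub>v unit_vec n j"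
    have w: "w \<in> carrier_vec n" using A less by (auto simp: w_def)
    have w0: "w $ i = 0" if "i < n" "j \<le> i" for i
    proof (cases "i = j")
      case True
      then show ?thesis using A d less that by (auto simp: w_def)
    next
      case False
      then have "j < i" using that by simp
      then show ?thesis using A less.prems that False by (auto simp: w_def dest: upper_triangularD)
    qed
    have cA: "A $$ (i, k) * w $ k = (if k = i then c * w $ i else 0)" if "i < n" "k < n" for i k
    proof (cases "k < j")
      case True
      have "A $$ (i, k) = col A k $ i" using A that by simp
      also have "\<dots> = (c \<cdot>\<^sub>v unit_vec n k) $ i" using less.IH[OF True] that by simp
      finally show ?thesis using that by auto
    next
      case False
      then show ?thesis using w0 that by auto
    qed
    have Aw: "A *\<^sub>v w = c \<cdot>\<^sub>v w"
    proof (rule eq_vecI)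
      fix i assume "i < dim_vec (c \<cdot>\<^sub>v w)"
      then have i: "i < n" using w by simp
      have "(A *\<^sub>v w) $ i = (\<Sum>k<n. A $$ (i, k) * w $ k)"
        using A w i by (simp add: scalar_prod_def lessThan_atLeast0)
      also have "\<dots> = c * w $ i" using cA i by simp
      finally show "(A *\<^sub>v w) $ i = (c \<cdot>\<^sub>v w) $ i" using w i by simp
    qed (use A w in auto)
    have Av: "A *\<^sub>v unit_vec n j = c \<cdot>\<^sub>v unit_vec n j + w"
      using A less.prems unfolding mult_mat_vec_unit[OF A(1) less.prems] w_def
      by (intro eq_vecI) auto
    obtain k where k: "m = Suc k" using m(2) by (cases m) auto
    have eq: "unit_vec n j = c ^ m \<cdot>\<^sub>v unit_vec n j + (of_nat m * c ^ k) \<cdot>\<^sub>v w"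
      using pow_mat_generalized_eigenvector[OF A(1) _ w Av Aw, of k] m(1) k by simp
    have *: "of_nat m * c ^ k * w $ i = 0" if i: "i < n" for i
    proof -
      have "unit_vec n j $ i = (c ^ m \<cdot>\<^sub>v unit_vec n j + (of_nat m * c ^ k) \<cdot>\<^sub>v w) $ i"
        by (rule arg_cong[OF eq])
      also have "\<dots> = c ^ m * unit_vec n j $ i + of_nat m * c ^ k * w $ i"
        using i w by (simp del: index_unit_vec(1))
      finally show ?thesis using pw[OF less.prems] by (simp del: index_unit_vec(1))
    qed
    have "c \<noteq> 0" using pw[OF less.prems] m(2) by (metis power_0_left less_irrefl zero_neq_one)
    then have "w $ i = 0" if "i < n" for i using *[OF that] m(2) by simp
    then show ?case
      using A less.prems unfolding w_def by (intro eq_vecI) (auto simp: index_unit_vec)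
  qed
  show ?thesis
  proof (rule eq_matI)
    fix i j assume "i < dim_row (c \<cdot>\<^sub>m 1\<^sub>m n)" "j < dim_col (c \<cdot>\<^sub>m 1\<^sub>m n :: 'c mat)"
    then have ij: "i < n" "j < n" by auto
    have "A $$ (i, j) = col A j $ i" using A ij by simp
    also have "\<dots> = (c \<cdot>\<^sub>v unit_vec n j) $ i" using col ij by simp
    finally show "A $$ (i, j) = (c \<cdot>\<^sub>m 1\<^sub>m n) $$ (i, j)" using ij by simp
  qed (use A in auto)
qed

text \<open>The numbers \<open>l i\<close> are the diagonal of a Schur triangular form.
  Diagonalizability of matrices of finite order enters through the third property, which treats the
  case of a single eigenvalue.\<close>

lemma finite_order_mat_eigenvalues:
  fixes A :: "complex mat"
  assumes A: "A \<in> carrier_mat n n" and m: "A ^\<^sub>m m = 1\<^sub>m n" "m > 0"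
  obtains l :: "nat \<Rightarrow> complex"
  where "\<And>i. i < n \<Longrightarrow> l i ^ m = 1"
    and "\<And>k. mat_trace (A ^\<^sub>m k) = (\<Sum>i<n. l i ^ k)"
    and "\<And>c. (\<And>i. i < n \<Longrightarrow> l i = c) \<Longrightarrow> A = c \<cdot>\<^sub>m 1\<^sub>m n"
proof -
  obtain es where es: "char_poly A = (\<Prod>a\<leftarrow>es. [:- a, 1:])"
    using char_poly_factorized[OF A] by auto
  obtain B P Q where "schur_decomposition A es = (B, P, Q)"
    by (cases "schur_decomposition A es") auto
  from schur_decomposition[OF A es this]
  have sim: "similar_mat_wit A B P Q" and ut: "upper_triangular B" by auto
  note w = similar_mat_witD2[OF A sim]
  have B: "B \<in> carrier_mat n n" using w by simp
  have simk: "similar_mat_wit (A ^\<^sub>m k) (B ^\<^sub>m k) P Q" for k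
    using similar_mat_wit_pow[OF sim] .
  have Bm: "B ^\<^sub>m m = 1\<^sub>m n"
  proof -
    have "similar_mat_wit (B ^\<^sub>m m) (1\<^sub>m n) Q P"
      using similar_mat_wit_sym[OF simk, of m] m by simp
    from similar_mat_witD2[OF _ this, of n n] B w show ?thesis by simp
  qed
  note pw = upper_triangular_pow[OF B ut]
  show thesis
  proof (rule that[of "\<lambda>i. B $$ (i, i)"])
    show "B $$ (i, i) ^ m = 1" if "i < n" for i
      using pw[of m] that Bm by simp
    show "mat_trace (A ^\<^sub>m k) = (\<Sum>i<n. B $$ (i, i) ^ k)" for k
    proof -
      have "A ^\<^sub>m k \<in> carrier_mat n n" using A by simp
      from mat_trace_similar[OF this simk] have "mat_trace (A ^\<^sub>m k) = mat_trace (B ^\<^sub>m k)" .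
      also have "\<dots> = (\<Sum>i<n. B $$ (i, i) ^ k)"
        using pw[of k] B pow_carrier_mat[OF B, of k] by (auto simp: mat_trace_def)
      finally show ?thesis .
    qed
    show "A = c \<cdot>\<^sub>m 1\<^sub>m n" if c: "\<And>i. i < n \<Longrightarrow> B $$ (i, i) = c" for c
    proof -
      have Bc: "B = c \<cdot>\<^sub>m 1\<^sub>m n"
        by (rule upper_triangular_finite_order_scalar[OF B ut Bm m(2) c])
      have "A = P * B * Q" using w by simp
      also have "\<dots> = c \<cdot>\<^sub>m (P * Q)" using w
        by (simp add: Bc mult_smult_distrib[OF _ one_carrier_mat] mult_smult_assoc_mat[of P n n])
      finally show ?thesis using w by simp
    qed
  qed
qed

text \<open>Equality case of the triangle inequality. The mean \<open>u\<close> has modulus 1; after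
  rotation by its conjugate every term has real part at most 1, and these real parts add up to
  \<open>card I\<close>, so each of them is 1.\<close>

lemma unit_complex_sum_eq_card:
  fixes l :: "'i \<Rightarrow> complex"
  assumes fin: "finite I" and l: "\<And>i. i \<in> I \<Longrightarrow> cmod (l i) = 1"
    and s: "cmod (\<Sum>i\<in>I. l i) = card I"
  obtains c where "\<And>i. i \<in> I \<Longrightarrow> l i = c"
proof (cases "I = {}")
  case True
  then show ?thesis using that[of 0] by simp
next
  case False
  define s where "s = (\<Sum>i\<in>I. l i)"
  have n0: "real (card I) > 0" using False fin by (simp add: card_gt_0_iff)
  define u where "u = s / of_nat (card I)"
  have s': "cmod s = card I" using s unfolding s_def .
  have u: "cmod u = 1" using s' n0 by (simp add: u_def norm_divide)
  have uc: "u * cnj u = 1" using u by (simp add: complex_norm_square[symmetric])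
  have le: "Re (l i * cnj u) \<le> 1" if "i \<in> I" for i
    using complex_Re_le_cmod[of "l i * cnj u"] l[OF that] u by (simp add: norm_mult)
  have "(\<Sum>i\<in>I. l i * cnj u) = s * cnj u" by (simp add: s_def sum_distrib_right)
  also have "\<dots> = of_nat (card I)"
    using uc n0 by (simp add: u_def field_simps)
  finally have "(\<Sum>i\<in>I. Re (l i * cnj u)) = card I"
    by (metis Re_sum complex_Re_of_nat)
  then have "(\<Sum>i\<in>I. 1 - Re (l i * cnj u)) = 0" by (simp add: sum_subtractf)
  then have re: "Re (l i * cnj u) = 1" if "i \<in> I" for i
    using le fin that by (subst (asm) sum_nonneg_eq_0_iff) auto
  have "l i = u" if i: "i \<in> I" for i
  proof -
    have c1: "cmod (l i * cnj u) = 1" using l[OF i] u by (simp add: norm_mult)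
    then have "Im (l i * cnj u) = 0"
      using re[OF i] by (simp add: cmod_def)
    then have "l i * cnj u = 1" using re[OF i] by (simp add: complex_eq_iff)
    then have "l i * (cnj u * u) = u" by (metis mult.assoc mult_1)
    then show ?thesis using uc by (simp add: mult.commute)
  qed
  then show ?thesis using that by blast
qed

text \<open>On an m-th root of unity the power m - 1 is the inverse, which is the conjugate.\<close>

lemma mat_trace_finite_order_cnj:
  fixes A :: "complex mat"
  assumes A: "A \<in> carrier_mat n n" and m: "A ^\<^sub>m m = 1\<^sub>m n" "m > 0"
  shows "mat_trace (A ^\<^sub>m (m - 1)) = cnj (mat_trace A)"
proof -
  from finite_order_mat_eigenvalues[OF A m] obtain l :: "nat \<Rightarrow> complex"
    where l: "\<And>i. i < n \<Longrightarrow> l i ^ m = 1" and t: "\<And>k. mat_trace (A ^\<^sub>m k) = (\<Sum>i<n. l i ^ k)"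
    by metis
  have "l i ^ (m - 1) = cnj (l i)" if "i < n" for i
  proof -
    have "cmod (l i) = 1"
      using l[OF that] m(2) by (metis norm_one norm_power norm_ge_zero power_eq_1_iff gr_implies_not0)
    then have "l i * cnj (l i) = 1" by (simp add: complex_norm_square[symmetric])
    moreover have "l i * l i ^ (m - 1) = 1" using l[OF that] m(2) by (metis power_eq_if gr_implies_not0)
    ultimately show ?thesis by (metis mult_cancel_left mult_zero_left zero_neq_one)
  qed
  then show ?thesis using t[of "m - 1"] t[of 1] A by (simp add: cnj_sum)
qed

text \<open>The trace is a sum of n complex numbers of modulus 1, so a trace of modulus n forces all
  eigenvalues to coincide.\<close>

lemma mat_finite_order_scalar:
  fixes A :: "complex mat"
  assumes A: "A \<in> carrier_mat n n" and m: "A ^\<^sub>m m = 1\<^sub>m n" "m > 0"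
    and t: "cmod (mat_trace A) = n"
  obtains c where "A = c \<cdot>\<^sub>m 1\<^sub>m n"
proof -
  from finite_order_mat_eigenvalues[OF A m] obtain l :: "nat \<Rightarrow> complex"
    where l: "\<And>i. i < n \<Longrightarrow> l i ^ m = 1" and tr: "\<And>k. mat_trace (A ^\<^sub>m k) = (\<Sum>i<n. l i ^ k)"
      and c: "\<And>c. (\<And>i. i < n \<Longrightarrow> l i = c) \<Longrightarrow> A = c \<cdot>\<^sub>m 1\<^sub>m n"
    by metis
  have n1: "cmod (l i) = 1" if "i < n" for i
    using l[OF that] m(2) by (metis norm_one norm_power norm_ge_zero power_eq_1_iff gr_implies_not0)
  have "mat_trace A = (\<Sum>i<n. l i)" using tr[of 1] A by simp
  then obtain c where "\<And>i. i < n \<Longrightarrow> l i = c"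
    using unit_complex_sum_eq_card[of "{..<n}" l] n1 t by auto
  then show ?thesis using c that by blast
qed

section \<open>Injective matrices and subspaces\<close>

text \<open>The dimensions are explicit because the type of matrices has no single zero that could
  serve as the empty sum.\<close>

definition sum_mats :: "nat \<Rightarrow> nat \<Rightarrow> ('i \<Rightarrow> 'c::comm_monoid_add mat) \<Rightarrow> 'i set \<Rightarrow> 'c mat" where
  "sum_mats nr nc f S = mat nr nc (\<lambda>(i, j). \<Sum>s\<in>S. f s $$ (i, j))"

lemma sum_mats_carrier [simp]: "sum_mats nr nc f S \<in> carrier_mat nr nc"
  by (simp add: sum_mats_def)

lemma sum_mats_cong: "(\<And>s. s \<in> S \<Longrightarrow> f s = g s) \<Longrightarrow> sum_mats nr nc f S = sum_mats nr nc g S"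
  by (auto simp: sum_mats_def intro!: eq_matI)

lemma sum_mats_reindex:
  "bij_betw h S T \<Longrightarrow> sum_mats nr nc (\<lambda>s. f (h s)) S = sum_mats nr nc f T"
  by (auto simp: sum_mats_def sum.reindex_bij_betw[where g = "\<lambda>s. f s $$ _"] intro!: eq_matI)

lemma mult_sum_mats:
  fixes A :: "'c :: comm_semiring_0 mat"
  assumes A: "A \<in> carrier_mat n nr" and f: "\<And>s. s \<in> S \<Longrightarrow> f s \<in> carrier_mat nr nc"
  shows "A * sum_mats nr nc f S = sum_mats n nc (\<lambda>s. A * f s) S"
proof (rule eq_matI)
  fix i j assume "i < dim_row (sum_mats n nc (\<lambda>s. A * f s) S)" "j < dim_col (sum_mats n nc (\<lambda>s. A * f s) S)"
  then have ij: "i < n" "j < nc" by (auto simp: sum_mats_def)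
  have "(A * sum_mats nr nc f S) $$ (i, j) = (\<Sum>k<nr. \<Sum>s\<in>S. A $$ (i, k) * f s $$ (k, j))"
    using A ij by (simp add: sum_mats_def scalar_prod_def lessThan_atLeast0 sum_distrib_left)
  also have "\<dots> = (\<Sum>s\<in>S. \<Sum>k<nr. A $$ (i, k) * f s $$ (k, j))" by (rule sum.swap)
  also have "\<dots> = (\<Sum>s\<in>S. (A * f s) $$ (i, j))"
    using A f ij by (intro sum.cong) (auto simp: scalar_prod_def lessThan_atLeast0 dest!: f)
  finally show "(A * sum_mats nr nc f S) $$ (i, j) = sum_mats n nc (\<lambda>s. A * f s) S $$ (i, j)"
    using ij by (simp add: sum_mats_def)
qed (use A in \<open>auto simp: sum_mats_def\<close>)

lemma sum_mats_mult:
  fixes A :: "'c :: comm_semiring_0 mat"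
  assumes A: "A \<in> carrier_mat nc n" and f: "\<And>s. s \<in> S \<Longrightarrow> f s \<in> carrier_mat nr nc"
  shows "sum_mats nr nc f S * A = sum_mats nr n (\<lambda>s. f s * A) S"
proof (rule eq_matI)
  fix i j assume "i < dim_row (sum_mats nr n (\<lambda>s. f s * A) S)" "j < dim_col (sum_mats nr n (\<lambda>s. f s * A) S)"
  then have ij: "i < nr" "j < n" by (auto simp: sum_mats_def)
  have "(sum_mats nr nc f S * A) $$ (i, j) = (\<Sum>k<nc. \<Sum>s\<in>S. f s $$ (i, k) * A $$ (k, j))"
    using A ij by (simp add: sum_mats_def scalar_prod_def lessThan_atLeast0 sum_distrib_right)
  also have "\<dots> = (\<Sum>s\<in>S. \<Sum>k<nc. f s $$ (i, k) * A $$ (k, j))" by (rule sum.swap)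
  also have "\<dots> = (\<Sum>s\<in>S. (f s * A) $$ (i, j))"
    using A f ij by (intro sum.cong) (auto simp: scalar_prod_def lessThan_atLeast0 dest!: f)
  finally show "(sum_mats nr nc f S * A) $$ (i, j) = sum_mats nr n (\<lambda>s. f s * A) S $$ (i, j)"
    using ij by (simp add: sum_mats_def)
qed (use A in \<open>auto simp: sum_mats_def\<close>)

lemma smult_sum_mats:
  fixes c :: "'c :: comm_semiring_0"
  assumes "\<And>s. s \<in> S \<Longrightarrow> f s \<in> carrier_mat nr nc"
  shows "sum_mats nr nc (\<lambda>s. c \<cdot>\<^sub>m f s) S = c \<cdot>\<^sub>m sum_mats nr nc f S"
  using assms by (auto simp: sum_mats_def sum_distrib_left dest!: assms intro!: eq_matI sum.cong)

lemma mat_trace_sum_mats: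
  assumes "\<And>s. s \<in> S \<Longrightarrow> f s \<in> carrier_mat n n"
  shows "mat_trace (sum_mats n n f S) = (\<Sum>s\<in>S. mat_trace (f s))"
proof -
  have "mat_trace (sum_mats n n f S) = (\<Sum>s\<in>S. \<Sum>i<n. f s $$ (i, i))"
    by (subst sum.swap) (simp add: mat_trace_def sum_mats_def)
  also have "\<dots> = (\<Sum>s\<in>S. mat_trace (f s))"
    by (intro sum.cong) (auto simp: mat_trace_def dest!: assms)
  finally show ?thesis .
qed

lemma mat_eq_by_vec:
  fixes A B :: "'c :: semiring_1 mat"
  assumes "A \<in> carrier_mat n m" "B \<in> carrier_mat n m"
    and "\<And>j. j < m \<Longrightarrow> A *\<^sub>v unit_vec m j = B *\<^sub>v unit_vec m j"
  shows "A = B"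
  using assms by (intro mat_col_eqI) (auto simp: mult_mat_vec_unit)

text \<open>Injectivity is linear independence of the columns, so an injective matrix with range W
  records a basis of W.\<close>

definition injective_mat :: "'c :: semiring_0 mat \<Rightarrow> bool" where
  "injective_mat A \<longleftrightarrow> (\<forall>v\<in>carrier_vec (dim_col A). A *\<^sub>v v = 0\<^sub>v (dim_row A) \<longrightarrow> v = 0\<^sub>v (dim_col A))"

definition mat_range :: "'c :: semiring_0 mat \<Rightarrow> 'c vec set" where
  "mat_range A = (\<lambda>v. A *\<^sub>v v) ` carrier_vec (dim_col A)"

lemma injective_matD:
  assumes "injective_mat A" "A \<in> carrier_mat n m" "v \<in> carrier_vec m" "A *\<^sub>v v = 0\<^sub>v n"
  shows "v = 0\<^sub>v m"
  using assms by (auto simp: injective_mat_def)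

lemma injective_mat_cancel_left:
  fixes A :: "'c :: field mat"
  assumes A: "injective_mat A" "A \<in> carrier_mat n m"
    and X: "X \<in> carrier_mat m k" "Y \<in> carrier_mat m k" and eq: "A * X = A * Y"
  shows "X = Y"
proof (rule mat_eq_by_vec[OF X])
  fix j assume "j < k"
  let ?e = "unit_vec k j :: 'c vec"
  have v: "X *\<^sub>v ?e \<in> carrier_vec m" "Y *\<^sub>v ?e \<in> carrier_vec m" using X by auto
  have "A *\<^sub>v (X *\<^sub>v ?e - Y *\<^sub>v ?e) = (A * X) *\<^sub>v ?e - (A * Y) *\<^sub>v ?e"
    using A X v by (simp add: mult_minus_distrib_mat_vec[OF A(2) v])
  also have "\<dots> = 0\<^sub>v n" using eq A X by auto
  finally have "X *\<^sub>v ?e - Y *\<^sub>v ?e = 0\<^sub>v m" using v injective_matD[OF A] by auto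
  then have d: "(X *\<^sub>v ?e - Y *\<^sub>v ?e) $ i = 0\<^sub>v m $ i" for i by simp
  show "X *\<^sub>v ?e = Y *\<^sub>v ?e"
  proof (rule eq_vecI)
    fix i assume "i < dim_vec (Y *\<^sub>v ?e)"
    then have "i < m" using X by simp
    then show "(X *\<^sub>v ?e) $ i = (Y *\<^sub>v ?e) $ i" using d[of i] X v by (simp add: carrier_vecD)
  qed (use X in auto)
qed

lemma injective_mat_mult:
  fixes A :: "'c :: semiring_1 mat"
  assumes "injective_mat A" "A \<in> carrier_mat n m" "injective_mat B" "B \<in> carrier_mat m k"
  shows "injective_mat (A * B)"
  unfolding injective_mat_def
proof (intro ballI impI)
  fix v assume v: "v \<in> carrier_vec (dim_col (A * B))" and "(A * B) *\<^sub>v v = 0\<^sub>v (dim_row (A * B))"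
  then have "A *\<^sub>v (B *\<^sub>v v) = 0\<^sub>v n" using assms by simp
  then have "B *\<^sub>v v = 0\<^sub>v m" using assms v by (intro injective_matD[of A n m]) auto
  then show "v = 0\<^sub>v (dim_col (A * B))" using assms v by (auto intro: injective_matD[of B m k])
qed

text \<open>A matrix with more columns than rows is padded by zero rows to a square one. Its
  transpose kills the n-th unit vector, so the determinant is 0, and a kernel vector of the padded
  matrix is one of \<open>A\<close>.\<close>

lemma injective_mat_dim_le:
  fixes A :: "'c :: field mat"
  assumes A: "injective_mat A" "A \<in> carrier_mat n m"
  shows "m \<le> n"
proof (rule ccontr)
  assume "\<not> m \<le> n"
  then have nm: "n < m" by simp
  define C where "C = mat m m (\<lambda>(i, j). if i < n then A $$ (i, j) else 0)"
  have C: "C \<in> carrier_mat m m" by (simp add: C_def)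
  have "transpose_mat C *\<^sub>v unit_vec m n = col (transpose_mat C) n"
    using C nm by (intro mult_mat_vec_unit) auto
  also have "\<dots> = 0\<^sub>v m" using nm C by (auto simp: C_def)
  finally have "det (transpose_mat C) = 0"
    using C nm unfolding det_0_iff_vec_prod_zero_field[OF transpose_carrier_mat[THEN iffD2, OF C]]
    by (intro exI[of _ "unit_vec m n"]) auto
  then have "det C = 0" using det_transpose[OF C] by simp
  then obtain v where v: "v \<in> carrier_vec m" "v \<noteq> 0\<^sub>v m" "C *\<^sub>v v = 0\<^sub>v m"
    using det_0_iff_vec_prod_zero_field[OF C] by auto
  have "A *\<^sub>v v = 0\<^sub>v n"
  proof (rule eq_vecI)
    fix i assume "i < dim_vec (0\<^sub>v n :: 'c vec)"
    then have i: "i < n" by simp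
    have "row A i = row C i" using i nm A by (intro eq_vecI) (auto simp: C_def)
    then have "(A *\<^sub>v v) $ i = (C *\<^sub>v v) $ i" using i nm A C by simp
    then show "(A *\<^sub>v v) $ i = 0\<^sub>v n $ i" using v i nm by simp
  qed (use A in auto)
  then show False using injective_matD[OF A v(1)] v(2) by simp
qed

lemma injective_mat_square_range:
  fixes A :: "'c :: field mat"
  assumes A: "injective_mat A" "A \<in> carrier_mat n n"
  shows "mat_range A = carrier_vec n"
proof -
  have "det A \<noteq> 0"
    using det_0_iff_vec_prod_zero_field[OF A(2)] injective_matD[OF A] by auto
  then obtain B where B: "B \<in> carrier_mat n n" "A * B = 1\<^sub>m n"
    using det_non_zero_imp_unit[OF A(2)] by (auto simp: Units_def ring_mat_simps)
  have "v \<in> mat_range A" if v: "v \<in> carrier_vec n" for v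
  proof -
    have "v = A *\<^sub>v (B *\<^sub>v v)" using assoc_mult_mat_vec[OF A(2) B(1) v] B v by simp
    moreover have "B *\<^sub>v v \<in> carrier_vec (dim_col A)" using A B v by simp
    ultimately show ?thesis unfolding mat_range_def by blast
  qed
  then show ?thesis using A by (auto simp: mat_range_def)
qed

text \<open>The columns of \<open>S\<close> are coordinates of the columns of \<open>D\<close> with
  respect to those of \<open>B\<close>. Applied to \<open>\<rho> g * B\<close> it yields the matrix
  of g on an invariant subspace with basis \<open>B\<close>.\<close>

lemma mat_factor_range:
  fixes B D :: "'c :: semiring_1 mat"
  assumes B: "B \<in> carrier_mat n m" and D: "D \<in> carrier_mat n k"
    and r: "\<And>v. v \<in> carrier_vec k \<Longrightarrow> D *\<^sub>v v \<in> mat_range B"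
  obtains S where "S \<in> carrier_mat m k" "D = B * S"
proof -
  have "\<exists>s\<in>carrier_vec m. D *\<^sub>v unit_vec k j = B *\<^sub>v s" for j
    using r[of "unit_vec k j"] B by (auto simp: mat_range_def)
  then obtain s where s: "\<And>j. s j \<in> carrier_vec m" "\<And>j. D *\<^sub>v unit_vec k j = B *\<^sub>v s j"
    by metis
  define S where "S = mat m k (\<lambda>(i, j). s j $ i)"
  have S: "S \<in> carrier_mat m k" by (simp add: S_def)
  have "D = B * S"
  proof (rule mat_eq_by_vec[OF D])
    fix j assume j: "j < k"
    have "S *\<^sub>v unit_vec k j = s j"
      unfolding mult_mat_vec_unit[OF S j] using s(1)[of j] j by (auto simp: S_def)
    then show "D *\<^sub>v unit_vec k j = B * S *\<^sub>v unit_vec k j"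
      using s(2)[of j] assoc_mult_mat_vec[OF B S, of "unit_vec k j"] by simp
  qed (use B S in auto)
  then show thesis using that S by blast
qed

lemma subspace_vec_iff:
  "VectorSpace.subspace class_ring W (module_vec TYPE('c::field) n) \<longleftrightarrow>
    W \<subseteq> carrier_vec n \<and> 0\<^sub>v n \<in> W \<and> (\<forall>v\<in>W. \<forall>w\<in>W. v + w \<in> W) \<and> (\<forall>c. \<forall>v\<in>W. c \<cdot>\<^sub>v v \<in> W)"
proof -
  interpret vectorspace class_ring "module_vec TYPE('c) n" by (rule vec_vs)
  show ?thesis
    using module_axioms vectorspace_axioms
    unfolding VectorSpace.subspace_def submodule_def by (auto simp: module_vec_simps)
qed

text \<open>Take the largest number of independent columns with range inside \<open>W\<close>; it
  exists because n bounds it. A vector of \<open>W\<close> outside the range could be appended as a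
  further column, against maximality.\<close>

lemma subspace_basis_mat:
  fixes W :: "'c :: field vec set"
  assumes "VectorSpace.subspace class_ring W (module_vec TYPE('c) n)"
  obtains m B where "B \<in> carrier_mat n m" "injective_mat B" "mat_range B = W"
proof -
  have W: "W \<subseteq> carrier_vec n" "0\<^sub>v n \<in> W" "\<And>v w. v \<in> W \<Longrightarrow> w \<in> W \<Longrightarrow> v + w \<in> W"
    "\<And>c v. v \<in> W \<Longrightarrow> c \<cdot>\<^sub>v v \<in> W"
    using assms by (auto simp: subspace_vec_iff)
  define P where "P m \<longleftrightarrow> (\<exists>B. B \<in> carrier_mat n m \<and> injective_mat B \<and> mat_range B \<subseteq> W)" for m
  have "P 0" unfolding P_def
  proof (intro exI conjI)
    show "0\<^sub>m n 0 \<in> carrier_mat n 0" by simp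
    show "injective_mat (0\<^sub>m n 0 :: 'c mat)" by (auto simp: injective_mat_def)
    have "0\<^sub>m n 0 *\<^sub>v v = 0\<^sub>v n" if "v \<in> carrier_vec 0" for v :: "'c vec"
      using that by (auto simp: scalar_prod_def)
    then show "mat_range (0\<^sub>m n 0 :: 'c mat) \<subseteq> W" using W by (auto simp: mat_range_def)
  qed
  have bd: "\<And>m. P m \<Longrightarrow> m \<le> n" using injective_mat_dim_le by (auto simp: P_def)
  define m where "m = (GREATEST m. P m)"
  have "P m" unfolding m_def using \<open>P 0\<close> bd by (rule GreatestI_nat)
  then obtain B where B: "B \<in> carrier_mat n m" "injective_mat B" "mat_range B \<subseteq> W"
    by (auto simp: P_def)
  have "u \<in> mat_range B" if u: "u \<in> W" for u
  proof (rule ccontr)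
    assume nr: "u \<notin> mat_range B"
    define C where "C = mat n (Suc m) (\<lambda>(i, j). if j < m then B $$ (i, j) else u $ i)"
    have C: "C \<in> carrier_mat n (Suc m)" by (simp add: C_def)
    have uc: "u \<in> carrier_vec n" using u W by auto
    \<comment> \<open>Drops the last coordinate, so that \<open>C\<close> acts as \<open>B\<close>
      on the remaining ones, plus the last coordinate times \<open>u\<close>.\<close>
    define t where "t v = vec m (\<lambda>i. v $ i)" for v :: "'c vec"
    have Cv: "C *\<^sub>v v = B *\<^sub>v t v + v $ m \<cdot>\<^sub>v u" if "v \<in> carrier_vec (Suc m)" for v
      using that B uc by (intro eq_vecI) (auto simp: C_def t_def scalar_prod_def mult.commute)
    have tc: "t v \<in> carrier_vec m" for v by (simp add: t_def)
    have "injective_mat C" unfolding injective_mat_def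
    proof (intro ballI impI)
      fix v assume "v \<in> carrier_vec (dim_col C)" "C *\<^sub>v v = 0\<^sub>v (dim_row C)"
      then have v: "v \<in> carrier_vec (Suc m)" "B *\<^sub>v t v + v $ m \<cdot>\<^sub>v u = 0\<^sub>v n" using C Cv by auto
      have "v $ m = 0"
      proof (rule ccontr)
        assume nz: "v $ m \<noteq> 0"
        have "u = B *\<^sub>v ((- 1 / v $ m) \<cdot>\<^sub>v t v)"
        proof (rule eq_vecI)
          fix i assume "i < dim_vec (B *\<^sub>v ((- 1 / v $ m) \<cdot>\<^sub>v t v))"
          then have i: "i < n" using B by simp
          have "(B *\<^sub>v t v + v $ m \<cdot>\<^sub>v u) $ i = 0" using v(2) i by simp
          then have "(B *\<^sub>v t v) $ i + v $ m * u $ i = 0" using i uc by simp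
          then have "u $ i = (- 1 / v $ m) * (B *\<^sub>v t v) $ i" using nz
            by (simp add: field_simps eq_neg_iff_add_eq_0)
          then show "u $ i = (B *\<^sub>v ((- 1 / v $ m) \<cdot>\<^sub>v t v)) $ i"
            using i B unfolding mult_mat_vec[OF B(1) tc] by simp
        qed (use B uc in auto)
        moreover have "(- 1 / v $ m) \<cdot>\<^sub>v t v \<in> carrier_vec (dim_col B)" using B tc by simp
        ultimately show False using nr unfolding mat_range_def by blast
      qed
      then have "v $ m \<cdot>\<^sub>v u = 0\<^sub>v n" using uc by (intro eq_vecI) auto
      then have "B *\<^sub>v t v = 0\<^sub>v n" using v(2) uc B(1) tc[of v]
        by auto
      then have "t v = 0\<^sub>v m" using injective_matD[OF B(2,1) tc] by blast
      then have "v $ i = 0" if "i < m" for i using that unfolding t_def by (metis index_vec index_zero_vec(1))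
      then show "v = 0\<^sub>v (dim_col C)" using \<open>v $ m = 0\<close> v(1) C
        by (intro eq_vecI) (auto simp: less_Suc_eq)
    qed
    moreover have "mat_range C \<subseteq> W"
    proof
      fix w assume "w \<in> mat_range C"
      then obtain v where v: "v \<in> carrier_vec (Suc m)" "w = C *\<^sub>v v" using C by (auto simp: mat_range_def)
      have "B *\<^sub>v t v \<in> W" using B tc[of v] by (auto simp: mat_range_def)
      then show "w \<in> W" using v Cv W u by auto
    qed
    ultimately have "P (Suc m)" using C by (auto simp: P_def)
    then have "Suc m \<le> m" unfolding m_def using Greatest_le_nat[of P "Suc m" n] bd m_def by auto
    then show False by simp
  qed
  then show thesis using that B by blast
qed

section \<open>Representations\<close>

locale representation = group G for G (structure) +
  fixes n :: nat and \<rho> :: "'a \<Rightarrow> complex mat"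
  assumes rep: "is_representation G n \<rho>"

text \<open>Replaces the unit group by plain matrices: \<open>\<rho> (inv g)\<close> supplies the
  inverse of \<open>\<rho> g\<close>. The value at the identity has to be listed, since a
  multiplicative map into all matrices may send it to a proper idempotent.\<close>

lemma (in group) is_representation_iff:
  "is_representation G n \<rho> \<longleftrightarrow> (\<forall>g\<in>carrier G. \<rho> g \<in> carrier_mat n n) \<and>
    (\<forall>g\<in>carrier G. \<forall>h\<in>carrier G. \<rho> (g \<otimes> h) = \<rho> g * \<rho> h) \<and> \<rho> \<one> = 1\<^sub>m n"
  (is "?L \<longleftrightarrow> ?R")
proof
  let ?M = "ring_mat TYPE(complex) n ()"
  interpret M: ring ?M by (rule ring_mat)
  assume ?L
  then have h: "\<rho> \<in> hom G (units_of ?M)" by (simp add: is_representation_def)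
  have "\<rho> \<one> = \<one>\<^bsub>units_of ?M\<^esub>" by (rule hom_one[OF h is_group M.units_group])
  then have "\<rho> \<one> = 1\<^sub>m n" by (simp add: units_of_one ring_mat_simps)
  moreover have "\<rho> g \<in> carrier_mat n n" if "g \<in> carrier G" for g
  proof -
    have "\<rho> g \<in> Units ?M" using hom_in_carrier[OF h that] by (simp add: units_of_carrier)
    then show ?thesis using M.Units_closed by (simp add: ring_mat_simps)
  qed
  moreover have "\<rho> (g \<otimes> k) = \<rho> g * \<rho> k" if "g \<in> carrier G" "k \<in> carrier G" for g k
    using hom_mult[OF h that] by (simp add: units_of_mult ring_mat_simps)
  ultimately show ?R by blast
next
  let ?M = "ring_mat TYPE(complex) n ()"
  assume R: ?R
  have "\<rho> g \<in> Units ?M" if g: "g \<in> carrier G" for g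
  proof -
    have "\<rho> (inv g) * \<rho> g = 1\<^sub>m n" "\<rho> g * \<rho> (inv g) = 1\<^sub>m n"
      using R g by (metis inv_closed l_inv, metis inv_closed r_inv)
    then show ?thesis using R g by (auto simp: Units_def ring_mat_simps)
  qed
  then show ?L using R
    by (auto simp: is_representation_def hom_def units_of_carrier units_of_mult ring_mat_simps)
qed

context representation
begin

lemma rep_carrier [simp]: "g \<in> carrier G \<Longrightarrow> \<rho> g \<in> carrier_mat n n"
  and rep_mult: "g \<in> carrier G \<Longrightarrow> h \<in> carrier G \<Longrightarrow> \<rho> (g \<otimes> h) = \<rho> g * \<rho> h"
  and rep_one [simp]: "\<rho> \<one> = 1\<^sub>m n"
  using rep by (auto simp: is_representation_iff)

lemma rep_inv:
  assumes "g \<in> carrier G"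
  shows "\<rho> (inv g) * \<rho> g = 1\<^sub>m n" "\<rho> g * \<rho> (inv g) = 1\<^sub>m n"
  using assms by (simp_all flip: rep_mult)

lemma rep_pow: "g \<in> carrier G \<Longrightarrow> \<rho> (g [^] k) = \<rho> g ^\<^sub>m k" for k :: nat
  by (induction k) (auto simp: rep_mult carrier_matD[OF rep_carrier])

lemma character_eq: "g \<in> carrier G \<Longrightarrow> character_of G \<rho> g = mat_trace (\<rho> g)"
  by (simp add: character_of_def)

lemma character_one [simp]: "character_of G \<rho> \<one> = of_nat n"
  by (simp add: character_eq mat_trace_def)

text \<open>A non-zero invariant subspace of minimal dimension is irreducible; the columns of \<open>B\<close> form
  a basis of it.\<close>

lemma irreducible_subrepresentation:
  assumes W: "VectorSpace.subspace class_ring W (module_vec TYPE(complex) n)" "W \<noteq> {0\<^sub>v n}"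
    and inv: "\<And>g w. g \<in> carrier G \<Longrightarrow> w \<in> W \<Longrightarrow> \<rho> g *\<^sub>v w \<in> W"
  obtains m B \<sigma> where "is_irreducible_representation G m \<sigma>" "B \<in> carrier_mat n m"
    "injective_mat B" "mat_range B \<subseteq> W" "\<And>g. g \<in> carrier G \<Longrightarrow> \<rho> g * B = B * \<sigma> g"
proof -
  \<comment> \<open>An invariant subspace of \<open>W\<close> is encoded by a basis matrix
    \<open>B\<close>, and \<open>S\<close> is the matrix of g in this basis. The condition m > 0
    excludes the zero subspace.\<close>
  define P where "P m \<longleftrightarrow> m > 0 \<and> (\<exists>B. B \<in> carrier_mat n m \<and> injective_mat B \<and> mat_range B \<subseteq> W \<and>
    (\<forall>g\<in>carrier G. \<exists>S\<in>carrier_mat m m. \<rho> g * B = B * S))" for m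
  have "\<exists>m. P m"
  proof -
    obtain m B where B: "B \<in> carrier_mat n m" "injective_mat B" "mat_range B = W"
      using subspace_basis_mat[OF W(1)] .
    have "m > 0"
    proof (rule ccontr)
      assume "\<not> m > 0"
      then have "mat_range B \<subseteq> {0\<^sub>v n}" using B(1) by (auto simp: mat_range_def scalar_prod_def)
      moreover have "0\<^sub>v n \<in> W" using W(1) unfolding subspace_vec_iff by blast
      ultimately show False using W(2) B(3) by blast
    qed
    moreover have "\<exists>S\<in>carrier_mat m m. \<rho> g * B = B * S" if g: "g \<in> carrier G" for g
    proof -
      have "\<rho> g * B *\<^sub>v v \<in> mat_range B" if "v \<in> carrier_vec m" for v
      proof -
        have "B *\<^sub>v v \<in> W" using B that by (auto simp: mat_range_def)
        then have "\<rho> g *\<^sub>v (B *\<^sub>v v) \<in> W" by (rule inv[OF g])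
        then show ?thesis using B(3) assoc_mult_mat_vec[OF rep_carrier[OF g] B(1) that] by simp
      qed
      then show ?thesis
        using mat_factor_range[OF B(1) mult_carrier_mat[OF rep_carrier[OF g] B(1)]] by blast
    qed
    ultimately show ?thesis using B unfolding P_def by blast
  qed
  define m where "m = (LEAST m. P m)"
  have "P m" using \<open>\<exists>m. P m\<close> unfolding m_def by (rule LeastI_ex)
  then obtain B where m0: "m > 0" and B: "B \<in> carrier_mat n m" "injective_mat B" "mat_range B \<subseteq> W"
    and BS: "\<forall>g\<in>carrier G. \<exists>S\<in>carrier_mat m m. \<rho> g * B = B * S"
    unfolding P_def by (elim conjE exE) (rule that)
  define \<sigma> where "\<sigma> g = (SOME S. S \<in> carrier_mat m m \<and> \<rho> g * B = B * S)" for g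
  have "\<sigma> g \<in> carrier_mat m m \<and> \<rho> g * B = B * \<sigma> g" if "g \<in> carrier G" for g
    unfolding \<sigma>_def by (rule someI_ex[OF bspec[OF BS that, unfolded Bex_def]])
  then have \<sigma>: "\<And>g. g \<in> carrier G \<Longrightarrow> \<sigma> g \<in> carrier_mat m m"
    and B\<sigma>: "\<And>g. g \<in> carrier G \<Longrightarrow> \<rho> g * B = B * \<sigma> g" by auto
  \<comment> \<open>The laws of a representation hold for \<sigma> after multiplication by
    \<open>B\<close> from the left, and injectivity of \<open>B\<close> lets them descend.\<close>
  have "\<sigma> \<one> = 1\<^sub>m m"
    using B\<sigma>[of \<one>] B by (intro injective_mat_cancel_left[OF B(2,1) \<sigma>]) auto
  moreover have "\<sigma> (g \<otimes> h) = \<sigma> g * \<sigma> h" if gh: "g \<in> carrier G" "h \<in> carrier G" for g h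
  proof (rule injective_mat_cancel_left[OF B(2,1)])
    have "B * \<sigma> (g \<otimes> h) = \<rho> g * (\<rho> h * B)"
      using gh B\<sigma>[of "g \<otimes> h"] B by (simp add: rep_mult assoc_mult_mat[of _ n n _ n _ m])
    also have "\<dots> = \<rho> g * B * \<sigma> h"
      unfolding B\<sigma>[OF gh(2)] using gh
      by (intro assoc_mult_mat[symmetric, OF rep_carrier B(1) \<sigma>])
    also have "\<dots> = B * (\<sigma> g * \<sigma> h)"
      unfolding B\<sigma>[OF gh(1)] using gh by (intro assoc_mult_mat[OF B(1) \<sigma> \<sigma>])
    finally show "B * \<sigma> (g \<otimes> h) = B * (\<sigma> g * \<sigma> h)" .
    show "\<sigma> (g \<otimes> h) \<in> carrier_mat m m" "\<sigma> g * \<sigma> h \<in> carrier_mat m m"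
      using gh mult_carrier_mat[OF \<sigma> \<sigma>] by (auto intro: \<sigma>)
  qed
  ultimately have r: "is_representation G m \<sigma>" using \<sigma> unfolding is_representation_iff by blast
  have "is_irreducible_representation G m \<sigma>"
    unfolding is_irreducible_representation_def
  proof (intro conjI r m0 allI impI)
    fix U assume U: "VectorSpace.subspace class_ring U (module_vec TYPE(complex) m)"
      and Uinv: "\<forall>g\<in>carrier G. \<forall>w\<in>U. \<sigma> g *\<^sub>v w \<in> U"
    obtain k C where C: "C \<in> carrier_mat m k" "injective_mat C" "mat_range C = U"
      using subspace_basis_mat[OF U] .
    show "U = {0\<^sub>v m} \<or> U = carrier_vec m"
    proof (cases "k = 0")
      case True
      then have "mat_range C \<subseteq> {0\<^sub>v m}" using C(1) by (auto simp: mat_range_def scalar_prod_def)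
      moreover have "0\<^sub>v m \<in> U" using U unfolding subspace_vec_iff by blast
      ultimately show ?thesis using C(3) by blast
    next
      case False
      \<comment> \<open>The columns of \<open>B * C\<close> form a basis of the subspace of
        \<open>W\<close> that corresponds to \<open>U\<close>; it is again invariant, so minimality
        of m gives m \<le> k.\<close>
      have "P k" unfolding P_def
      proof (intro conjI exI ballI)
        show "k > 0" using False by simp
        show BC: "B * C \<in> carrier_mat n k" using B C by simp
        show "injective_mat (B * C)" using injective_mat_mult[OF B(2,1) C(2,1)] .
        have "B * C *\<^sub>v v \<in> mat_range B" if "v \<in> carrier_vec k" for v
          using B C that by (auto simp: mat_range_def)
        then show "mat_range (B * C) \<subseteq> W" using B C by (auto simp: mat_range_def)
        fix g assume g: "g \<in> carrier G"
        have "\<sigma> g * C *\<^sub>v v \<in> mat_range C" if "v \<in> carrier_vec k" for v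
        proof -
          have "C *\<^sub>v v \<in> U" using C that by (auto simp: mat_range_def)
          then have "\<sigma> g *\<^sub>v (C *\<^sub>v v) \<in> U" using Uinv g by blast
          then show ?thesis using C(3) assoc_mult_mat_vec[OF \<sigma>[OF g] C(1) that] by simp
        qed
        then obtain S where S: "S \<in> carrier_mat k k" "\<sigma> g * C = C * S"
          using mat_factor_range[OF C(1) mult_carrier_mat[OF \<sigma>[OF g] C(1)]] by blast
        have "\<rho> g * (B * C) = B * \<sigma> g * C"
          unfolding B\<sigma>[OF g, symmetric]
          by (rule assoc_mult_mat[OF rep_carrier[OF g] B(1) C(1), symmetric])
        also have "\<dots> = B * (\<sigma> g * C)" by (rule assoc_mult_mat[OF B(1) \<sigma>[OF g] C(1)])
        also have "\<dots> = B * C * S" unfolding S(2)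
          by (rule assoc_mult_mat[OF B(1) C(1) S(1), symmetric])
        finally show "\<exists>S\<in>carrier_mat k k. \<rho> g * (B * C) = B * C * S" using S by blast
      qed
      then have "m \<le> k" unfolding m_def by (rule Least_le)
      moreover have "k \<le> m" using injective_mat_dim_le[OF C(2,1)] .
      ultimately show ?thesis using injective_mat_square_range[of C m] C by (metis le_antisym)
    qed
  qed
  then show thesis using that B B\<sigma> by blast
qed

end

section \<open>Schur's lemma\<close>

locale irreducible_representation = representation +
  assumes irr: "is_irreducible_representation G n \<rho>"
begin

lemma degree_pos: "n > 0"
  using irr by (simp add: is_irreducible_representation_def)

text \<open>Over the complex numbers \<open>A\<close> has an eigenvalue, as n > 0. Its eigenspace is
  invariant because \<open>A\<close> commutes with the representation, and it is not zero, so it is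
  the whole space.\<close>

lemma schur_scalar:
  assumes A: "A \<in> carrier_mat n n" and comm: "\<And>g. g \<in> carrier G \<Longrightarrow> A * \<rho> g = \<rho> g * A"
  obtains c where "A = c \<cdot>\<^sub>m 1\<^sub>m n"
proof -
  obtain c where "eigenvalue A c"
    using spectrum_non_empty[OF A degree_pos] by (auto simp: spectrum_def)
  then obtain v where v: "v \<in> carrier_vec n" "v \<noteq> 0\<^sub>v n" "A *\<^sub>v v = c \<cdot>\<^sub>v v"
    using A by (auto simp: eigenvalue_def eigenvector_def)
  define U where "U = {w \<in> carrier_vec n. A *\<^sub>v w = c \<cdot>\<^sub>v w}"
  have "VectorSpace.subspace class_ring U (module_vec TYPE(complex) n)"
    unfolding subspace_vec_iff
  proof (intro conjI ballI allI)
    show "U \<subseteq> carrier_vec n" "0\<^sub>v n \<in> U" using A by (auto simp: U_def)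
    show "v + w \<in> U" if "v \<in> U" "w \<in> U" for v w
      using that A by (auto simp: U_def mult_add_distrib_mat_vec smult_add_distrib_vec)
    fix a w assume "w \<in> U"
    then have w: "w \<in> carrier_vec n" "A *\<^sub>v w = c \<cdot>\<^sub>v w" by (auto simp: U_def)
    have "A *\<^sub>v (a \<cdot>\<^sub>v w) = c \<cdot>\<^sub>v (a \<cdot>\<^sub>v w)"
      unfolding mult_mat_vec[OF A w(1)] w(2) smult_smult_assoc by (simp only: mult.commute)
    then show "a \<cdot>\<^sub>v w \<in> U" using w by (simp add: U_def)
  qed
  moreover have "\<rho> g *\<^sub>v w \<in> U" if g: "g \<in> carrier G" and "w \<in> U" for g w
  proof -
    have w: "w \<in> carrier_vec n" "A *\<^sub>v w = c \<cdot>\<^sub>v w" using that by (auto simp: U_def)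
    have "A *\<^sub>v (\<rho> g *\<^sub>v w) = \<rho> g *\<^sub>v (A *\<^sub>v w)"
      using comm[OF g] assoc_mult_mat_vec[OF A rep_carrier[OF g] w(1)]
        assoc_mult_mat_vec[OF rep_carrier[OF g] A w(1)] by simp
    also have "\<dots> = c \<cdot>\<^sub>v (\<rho> g *\<^sub>v w)" using w g by (simp add: mult_mat_vec[of _ n n])
    finally show ?thesis using mult_mat_vec_carrier[OF rep_carrier[OF g] w(1)] by (simp add: U_def)
  qed
  ultimately have "U = {0\<^sub>v n} \<or> U = carrier_vec n"
    using irr by (auto simp: is_irreducible_representation_def)
  moreover have "v \<in> U" using v by (simp add: U_def)
  ultimately have U: "U = carrier_vec n" using v(2) by blast
  have "A = c \<cdot>\<^sub>m 1\<^sub>m n"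
  proof (rule mat_eq_by_vec[OF A])
    fix j assume "j < n"
    have e: "unit_vec n j \<in> carrier_vec n" by simp
    then have "unit_vec n j \<in> U" by (simp only: U)
    then have "A *\<^sub>v unit_vec n j = c \<cdot>\<^sub>v unit_vec n j" by (simp add: U_def)
    also have "\<dots> = (c \<cdot>\<^sub>m 1\<^sub>m n) *\<^sub>v unit_vec n j"
      using \<open>j < n\<close> by (subst mult_mat_vec_unit[of _ n n]) auto
    finally show "A *\<^sub>v unit_vec n j = (c \<cdot>\<^sub>m 1\<^sub>m n) *\<^sub>v unit_vec n j" .
  qed simp
  then show thesis using that by blast
qed

end

section \<open>Averages over the group and orthogonality\<close>

context irreducible_representation
begin

text \<open>Conjugating the average by \<open>\<rho> h\<close> only permutes its summands, by the
  substitution of h g for g.\<close>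

lemma sum_conjugates_commute:
  assumes E: "E \<in> carrier_mat n n" and h: "h \<in> carrier G"
  defines "X \<equiv> sum_mats n n (\<lambda>g. \<rho> g * E * \<rho> (inv g)) (carrier G)"
  shows "X * \<rho> h = \<rho> h * X"
proof -
  have c: "\<rho> g * E * \<rho> (inv g) \<in> carrier_mat n n" if "g \<in> carrier G" for g
    using that E by (intro mult_carrier_mat[of _ n n]) auto
  have bij: "bij_betw (\<lambda>g. h \<otimes> g) (carrier G) (carrier G)"
    by (rule bij_betw_byWitness[where f' = "\<lambda>g. inv h \<otimes> g"])
       (use h in \<open>auto simp flip: m_assoc\<close>)
  have "X * \<rho> h = sum_mats n n (\<lambda>g. \<rho> g * E * \<rho> (inv g) * \<rho> h) (carrier G)"
    unfolding X_def by (rule sum_mats_mult[OF rep_carrier[OF h] c])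
  also have "\<dots> = sum_mats n n (\<lambda>g. \<rho> (h \<otimes> g) * E * \<rho> (inv (h \<otimes> g)) * \<rho> h) (carrier G)"
    by (rule sum_mats_reindex[OF bij, symmetric])
  also have "\<dots> = sum_mats n n (\<lambda>g. \<rho> h * (\<rho> g * E * \<rho> (inv g))) (carrier G)"
  proof (rule sum_mats_cong)
    fix g assume g: "g \<in> carrier G"
    have i: "inv (h \<otimes> g) \<otimes> h = inv g" using g h by (simp add: inv_mult_group m_assoc)
    have 1: "\<rho> (h \<otimes> g) * E * \<rho> (inv (h \<otimes> g)) * \<rho> h = \<rho> (h \<otimes> g) * E * (\<rho> (inv (h \<otimes> g)) * \<rho> h)"
      using g h E by (intro assoc_mult_mat[of _ n n _ n _ n]) (auto intro!: mult_carrier_mat[of _ n n])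
    have 2: "\<rho> (inv (h \<otimes> g)) * \<rho> h = \<rho> (inv g)" using g h i by (simp flip: rep_mult)
    have 3: "\<rho> (h \<otimes> g) * E = \<rho> h * (\<rho> g * E)"
      unfolding rep_mult[OF h g] using E g h by (intro assoc_mult_mat[of _ n n _ n _ n]) (auto intro!: mult_carrier_mat[of _ n n])
    have 4: "\<rho> h * (\<rho> g * E) * \<rho> (inv g) = \<rho> h * (\<rho> g * E * \<rho> (inv g))"
      using E g h by (intro assoc_mult_mat[of _ n n _ n _ n]) (auto intro!: mult_carrier_mat[of _ n n])
    show "\<rho> (h \<otimes> g) * E * \<rho> (inv (h \<otimes> g)) * \<rho> h = \<rho> h * (\<rho> g * E * \<rho> (inv g))"
      unfolding 1 2 unfolding 3 4 ..
  qed
  also have "\<dots> = \<rho> h * X"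
    unfolding X_def by (rule mult_sum_mats[OF rep_carrier[OF h] c, symmetric])
  finally show ?thesis .
qed

text \<open>Schur orthogonality for diagonal coefficients. Averaging the conjugates of the matrix
  unit \<open>E\<close> gives a scalar matrix; its (i, j) entry is the sum in question, while its
  trace is |G| times the trace of \<open>E\<close>.\<close>

lemma sum_matrix_coefficients:
  assumes fin: "finite (carrier G)" and ij: "i < n" "j < n"
  shows "of_nat n * (\<Sum>g\<in>carrier G. \<rho> g $$ (i, i) * \<rho> (inv g) $$ (j, j))
    = (if i = j then of_nat (card (carrier G)) else 0)"
proof -
  define E where "E = mat n n (\<lambda>(k, l). if k = i \<and> l = j then 1 else 0 :: complex)"
  have E: "E \<in> carrier_mat n n" by (simp add: E_def)
  define X where "X = sum_mats n n (\<lambda>g. \<rho> g * E * \<rho> (inv g)) (carrier G)"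
  have c: "\<rho> g * E * \<rho> (inv g) \<in> carrier_mat n n" if "g \<in> carrier G" for g
    using that E by (intro mult_carrier_mat[of _ n n]) auto
  obtain x where x: "X = x \<cdot>\<^sub>m 1\<^sub>m n"
    using schur_scalar[of X] sum_conjugates_commute[OF E] unfolding X_def by auto
  have entry: "(\<rho> g * E * \<rho> (inv g)) $$ (i, j) = \<rho> g $$ (i, i) * \<rho> (inv g) $$ (j, j)"
    if g: "g \<in> carrier G" for g
  proof -
    note R = rep_carrier[OF g] and R' = rep_carrier[OF inv_closed[OF g]]
    have RE: "(\<rho> g * E) $$ (i, l) = (if l = j then \<rho> g $$ (i, i) else 0)" if l: "l < n" for l
    proof -
      have "(\<rho> g * E) $$ (i, l) = (\<Sum>k<n. \<rho> g $$ (i, k) * E $$ (k, l))"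
        using R E ij l by (simp add: scalar_prod_def lessThan_atLeast0)
      also have "\<dots> = (\<Sum>k<n. if k = i then (if l = j then \<rho> g $$ (i, i) else 0) else 0)"
        using l by (intro sum.cong) (auto simp: E_def)
      finally show ?thesis using ij by simp
    qed
    have "(\<rho> g * E * \<rho> (inv g)) $$ (i, j) = (\<Sum>l<n. (\<rho> g * E) $$ (i, l) * \<rho> (inv g) $$ (l, j))"
      using R R' E ij by (simp add: scalar_prod_def lessThan_atLeast0 del: assoc_mult_mat)
    also have "\<dots> = (\<Sum>l<n. if l = j then \<rho> g $$ (i, i) * \<rho> (inv g) $$ (j, j) else 0)"
      by (intro sum.cong) (auto simp: RE)
    finally show ?thesis using ij by simp
  qed
  have tr: "mat_trace (\<rho> g * E * \<rho> (inv g)) = (if i = j then 1 else 0)" if g: "g \<in> carrier G" for g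
  proof -
    note R = rep_carrier[OF g] and R' = rep_carrier[OF inv_closed[OF g]]
    have "mat_trace (\<rho> g * E * \<rho> (inv g)) = mat_trace (\<rho> (inv g) * (\<rho> g * E))"
      using R R' E by (intro mat_trace_mult_comm[of _ n n]) auto
    also have "\<rho> (inv g) * (\<rho> g * E) = E"
      using assoc_mult_mat[OF R' R E] rep_inv(1)[OF g] E by simp
    also have "mat_trace E = (\<Sum>k<n. if k = i then (if i = j then 1 else 0) else 0)"
      unfolding mat_trace_def using E by (intro sum.cong) (auto simp: E_def)
    finally show ?thesis using ij by simp
  qed
  have "of_nat n * x = mat_trace X" by (simp add: x mat_trace_smult_one)
  also have "\<dots> = (\<Sum>g\<in>carrier G. mat_trace (\<rho> g * E * \<rho> (inv g)))"
    unfolding X_def by (rule mat_trace_sum_mats[OF c])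
  also have "\<dots> = (if i = j then of_nat (card (carrier G)) else 0)" using tr by simp
  finally have nx: "of_nat n * x = (if i = j then of_nat (card (carrier G)) else 0)" .
  have "(\<Sum>g\<in>carrier G. \<rho> g $$ (i, i) * \<rho> (inv g) $$ (j, j)) = X $$ (i, j)"
    using ij entry by (simp add: X_def sum_mats_def)
  also have "\<dots> = (if i = j then x else 0)" using ij by (simp add: x)
  finally show ?thesis using nx by (auto split: if_splits)
qed

text \<open>The norm relation for an irreducible character, with the inverse in place of the
  conjugate: expanding both traces leaves the n pairs i = j, each contributing |G| / n.\<close>

lemma sum_character_mult_inv:
  assumes "finite (carrier G)"
  shows "(\<Sum>g\<in>carrier G. mat_trace (\<rho> g) * mat_trace (\<rho> (inv g))) = of_nat (card (carrier G))"
proof -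
  let ?c = "of_nat (card (carrier G)) :: complex"
  have "(\<Sum>g\<in>carrier G. mat_trace (\<rho> g) * mat_trace (\<rho> (inv g)))
      = (\<Sum>g\<in>carrier G. \<Sum>i<n. \<Sum>j<n. \<rho> g $$ (i, i) * \<rho> (inv g) $$ (j, j))"
    using carrier_matD[OF rep_carrier] by (intro sum.cong) (auto simp: mat_trace_def sum_product)
  also have "\<dots> = (\<Sum>i<n. \<Sum>j<n. \<Sum>g\<in>carrier G. \<rho> g $$ (i, i) * \<rho> (inv g) $$ (j, j))"
    by (subst sum.swap, intro sum.cong refl, subst sum.swap) simp
  finally have "of_nat n * (\<Sum>g\<in>carrier G. mat_trace (\<rho> g) * mat_trace (\<rho> (inv g)))
      = (\<Sum>i<n. \<Sum>j<n. of_nat n * (\<Sum>g\<in>carrier G. \<rho> g $$ (i, i) * \<rho> (inv g) $$ (j, j)))"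
    by (simp only: sum_distrib_left)
  also have "\<dots> = (\<Sum>i<n. \<Sum>j<n. if i = j then ?c else 0)"
    using sum_matrix_coefficients[OF assms] by (intro sum.cong) auto
  also have "\<dots> = of_nat n * ?c" by simp
  finally show ?thesis using degree_pos by simp
qed

text \<open>The hypothesis says that \<open>f\<close> is constant on conjugacy classes, so
  conjugation by \<open>\<rho> h\<close> permutes the summands and Schur's lemma applies. The second
  equation is the trace of the first.\<close>

lemma class_function_sum_scalar:
  fixes f :: "'a \<Rightarrow> complex"
  assumes f: "\<And>g h. g \<in> carrier G \<Longrightarrow> h \<in> carrier G \<Longrightarrow> f (g \<otimes> h) = f (h \<otimes> g)"
  obtains c where "sum_mats n n (\<lambda>g. f g \<cdot>\<^sub>m \<rho> g) (carrier G) = c \<cdot>\<^sub>m 1\<^sub>m n"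
    "of_nat n * c = (\<Sum>g\<in>carrier G. f g * mat_trace (\<rho> g))"
proof -
  define X where "X = sum_mats n n (\<lambda>g. f g \<cdot>\<^sub>m \<rho> g) (carrier G)"
  have c: "f g \<cdot>\<^sub>m \<rho> g \<in> carrier_mat n n" if "g \<in> carrier G" for g using that by simp
  have comm: "X * \<rho> h = \<rho> h * X" if h: "h \<in> carrier G" for h
  proof -
    have "inv h \<otimes> (h \<otimes> x) = x" "h \<otimes> (inv h \<otimes> x) = x" if "x \<in> carrier G" for x
      using h that by (simp_all flip: m_assoc)
    note cancel = this
    have bij: "bij_betw (\<lambda>g. h \<otimes> g \<otimes> inv h) (carrier G) (carrier G)"
      by (rule bij_betw_byWitness[where f' = "\<lambda>g. inv h \<otimes> g \<otimes> h"])
         (use h in \<open>auto simp: m_assoc cancel\<close>)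
    have "X * \<rho> h = sum_mats n n (\<lambda>g. (f g \<cdot>\<^sub>m \<rho> g) * \<rho> h) (carrier G)"
      unfolding X_def by (rule sum_mats_mult[OF rep_carrier[OF h] c])
    also have "\<dots> = sum_mats n n (\<lambda>g. (f (h \<otimes> g \<otimes> inv h) \<cdot>\<^sub>m \<rho> (h \<otimes> g \<otimes> inv h)) * \<rho> h) (carrier G)"
      by (rule sum_mats_reindex[OF bij, symmetric])
    also have "\<dots> = sum_mats n n (\<lambda>g. \<rho> h * (f g \<cdot>\<^sub>m \<rho> g)) (carrier G)"
    proof (rule sum_mats_cong)
      fix g assume g: "g \<in> carrier G"
      have "f (h \<otimes> g \<otimes> inv h) = f (inv h \<otimes> (h \<otimes> g))" using g h by (intro f) auto
      also have "inv h \<otimes> (h \<otimes> g) = g" using g h by (simp flip: m_assoc)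
      finally have fg: "f (h \<otimes> g \<otimes> inv h) = f g" .
      have "h \<otimes> g \<otimes> inv h \<otimes> h = h \<otimes> g" using g h by (simp add: m_assoc)
      then have "\<rho> (h \<otimes> g \<otimes> inv h) * \<rho> h = \<rho> h * \<rho> g" using g h by (simp flip: rep_mult)
      then show "(f (h \<otimes> g \<otimes> inv h) \<cdot>\<^sub>m \<rho> (h \<otimes> g \<otimes> inv h)) * \<rho> h = \<rho> h * (f g \<cdot>\<^sub>m \<rho> g)"
        unfolding fg using g h
        by (subst mult_smult_distrib[of _ n n _ n], simp, simp, subst mult_smult_assoc_mat[of _ n n _ n], auto)
    qed
    also have "\<dots> = \<rho> h * X"
      unfolding X_def by (rule mult_sum_mats[OF rep_carrier[OF h] c, symmetric])
    finally show ?thesis .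
  qed
  obtain x where x: "X = x \<cdot>\<^sub>m 1\<^sub>m n" using schur_scalar[of X] comm by (auto simp: X_def)
  have "of_nat n * x = mat_trace X" by (simp add: x mat_trace_smult_one)
  also have "\<dots> = (\<Sum>g\<in>carrier G. mat_trace (f g \<cdot>\<^sub>m \<rho> g))"
    unfolding X_def by (rule mat_trace_sum_mats[OF c])
  also have "\<dots> = (\<Sum>g\<in>carrier G. f g * mat_trace (\<rho> g))"
    by (intro sum.cong) (auto simp: mat_trace_def sum_distrib_left carrier_matD[OF rep_carrier])
  finally show thesis using that x by (simp add: X_def)
qed

end

section \<open>Kernel and center of a character in terms of matrices\<close>

context representation
begin

lemma finite_order:
  assumes "finite (carrier G)" "g \<in> carrier G"
  shows "\<rho> g ^\<^sub>m card (carrier G) = 1\<^sub>m n" "card (carrier G) > 0"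
proof -
  show "card (carrier G) > 0" using assms by (auto simp: card_gt_0_iff)
  have "\<rho> (g [^] card (carrier G)) = 1\<^sub>m n"
    using pow_order_eq_1[OF assms(2)] by (simp add: Coset.order_def)
  then show "\<rho> g ^\<^sub>m card (carrier G) = 1\<^sub>m n" using assms by (simp add: rep_pow)
qed

text \<open>The inverse of g is its power with exponent |G| - 1, so the conjugation formula for
  matrices of finite order applies.\<close>

lemma mat_trace_inv:
  assumes "finite (carrier G)" "g \<in> carrier G"
  shows "mat_trace (\<rho> (inv g)) = cnj (mat_trace (\<rho> g))"
proof -
  note o = finite_order[OF assms]
  define N where "N = card (carrier G)"
  have "g [^] (N - 1) \<otimes> g = g [^] N" using o assms(2) unfolding N_def
    by (metis Suc_diff_1 nat_pow_Suc)
  also have "\<dots> = \<one>" using pow_order_eq_1[OF assms(2)] by (simp add: Coset.order_def N_def)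
  finally have "g [^] (N - 1) = inv g" using assms(2) by (metis inv_equality nat_pow_closed)
  then have "\<rho> (inv g) = \<rho> g ^\<^sub>m (N - 1)" using assms by (metis rep_pow)
  then show ?thesis using mat_trace_finite_order_cnj[OF rep_carrier[OF assms(2)] o] by (simp add: N_def)
qed

text \<open>One inclusion is the equality case of the triangle inequality for the eigenvalues. For
  the other, finite order makes the scalar a root of unity; degree 0 is allowed here and is treated
  apart.\<close>

lemma char_center_eq:
  assumes fin: "finite (carrier G)"
  shows "char_center G (character_of G \<rho>) = {g \<in> carrier G. \<exists>c. \<rho> g = c \<cdot>\<^sub>m 1\<^sub>m n}"
proof (intro equalityI subsetI)
  fix g assume "g \<in> char_center G (character_of G \<rho>)"
  then have g: "g \<in> carrier G" and "complex_of_real (cmod (mat_trace (\<rho> g))) = of_nat n"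
    by (auto simp: char_center_def character_eq)
  then have "cmod (mat_trace (\<rho> g)) = n" by (metis of_real_eq_iff of_real_of_nat_eq)
  from mat_finite_order_scalar[OF rep_carrier[OF g] finite_order[OF fin g] this] g
  show "g \<in> {g \<in> carrier G. \<exists>c. \<rho> g = c \<cdot>\<^sub>m 1\<^sub>m n}" by auto
next
  fix g assume "g \<in> {g \<in> carrier G. \<exists>c. \<rho> g = c \<cdot>\<^sub>m 1\<^sub>m n}"
  then obtain c where g: "g \<in> carrier G" and c: "\<rho> g = c \<cdot>\<^sub>m 1\<^sub>m n" by auto
  have "n = 0 \<or> cmod c = 1"
  proof (cases "n = 0")
    case False
    have "(c \<cdot>\<^sub>m 1\<^sub>m n) ^\<^sub>m k = (c ^ k) \<cdot>\<^sub>m 1\<^sub>m n" for k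
      by (induction k) (auto simp: mult_smult_distrib[of _ n n _ n] mult_smult_assoc_mat[of _ n n _ n] mult.commute)
    then have "c ^ card (carrier G) \<cdot>\<^sub>m 1\<^sub>m n = 1\<^sub>m n" using finite_order[OF fin g] c by simp
    then have "(c ^ card (carrier G) \<cdot>\<^sub>m 1\<^sub>m n) $$ (0, 0) = (1\<^sub>m n :: complex mat) $$ (0, 0)" by simp
    then have "c ^ card (carrier G) = 1" using False by simp
    then show ?thesis using finite_order(2)[OF fin g]
      by (metis norm_one norm_power norm_ge_zero power_eq_1_iff gr_implies_not0)
  qed simp
  then have "cmod (mat_trace (\<rho> g)) = n" by (auto simp: c mat_trace_smult_one norm_mult)
  then show "g \<in> char_center G (character_of G \<rho>)"
    using g by (simp add: char_center_def character_eq)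
qed

text \<open>A trace equal to n also has modulus n, so \<open>\<rho> g\<close> is a scalar matrix,
  and the trace then determines the scalar.\<close>

lemma char_kernel_eq:
  assumes fin: "finite (carrier G)"
  shows "char_kernel G (character_of G \<rho>) = {g \<in> carrier G. \<rho> g = 1\<^sub>m n}"
proof (intro equalityI subsetI)
  fix g assume "g \<in> char_kernel G (character_of G \<rho>)"
  then have g: "g \<in> carrier G" and t: "mat_trace (\<rho> g) = of_nat n"
    by (auto simp: char_kernel_def character_eq)
  then have "g \<in> char_center G (character_of G \<rho>)"
    by (simp add: char_center_def character_eq)
  then obtain c where c: "\<rho> g = c \<cdot>\<^sub>m 1\<^sub>m n" using char_center_eq[OF fin] by auto
  then have "n = 0 \<or> c = 1" using t by (simp add: mat_trace_smult_one)
  then have "\<rho> g = 1\<^sub>m n" using c by (auto intro!: eq_matI)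
  then show "g \<in> {g \<in> carrier G. \<rho> g = 1\<^sub>m n}" using g by simp
next
  fix g assume "g \<in> {g \<in> carrier G. \<rho> g = 1\<^sub>m n}"
  then show "g \<in> char_kernel G (character_of G \<rho>)"
    by (auto simp: char_kernel_def character_eq mat_trace_def)
qed

end

section \<open>Class functions\<close>

lemma cscalar_prod_mult_mat_vec:
  fixes A :: "complex mat"
  assumes A: "A \<in> carrier_mat n m" and u: "u \<in> carrier_vec m" and w: "w \<in> carrier_vec n"
  shows "(A *\<^sub>v u) \<bullet>c w = u \<bullet>c (mat m n (\<lambda>(i, j). cnj (A $$ (j, i))) *\<^sub>v w)"
proof -
  have "(A *\<^sub>v u) \<bullet>c w = (\<Sum>i<n. \<Sum>j<m. A $$ (i, j) * u $ j * cnj (w $ i))"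
    using A u w by (simp add: scalar_prod_def lessThan_atLeast0 sum_distrib_right)
  also have "\<dots> = (\<Sum>j<m. \<Sum>i<n. A $$ (i, j) * u $ j * cnj (w $ i))" by (rule sum.swap)
  also have "\<dots> = u \<bullet>c (mat m n (\<lambda>(i, j). cnj (A $$ (j, i))) *\<^sub>v w)"
    using A u w by (simp add: scalar_prod_def lessThan_atLeast0 sum_distrib_left ac_simps)
  finally show ?thesis .
qed

context group
begin

text \<open>The matrix \<open>F\<close> is the action of \<open>\<Sum> f(g) g\<close> on the regular representation, and \<open>F'\<close> is its
  adjoint. An irreducible constituent of the range of \<open>F'\<close> is annihilated by \<open>F\<close>,
  hence orthogonal to the range of \<open>F'\<close>.\<close>

lemma class_function_eq_zero:
  fixes f :: "'a \<Rightarrow> complex"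
  assumes fin: "finite (carrier G)"
    and f: "\<And>g h. g \<in> carrier G \<Longrightarrow> h \<in> carrier G \<Longrightarrow> f (g \<otimes> h) = f (h \<otimes> g)"
    and orth: "\<And>m \<sigma>. is_irreducible_representation G m \<sigma> \<Longrightarrow>
      (\<Sum>g\<in>carrier G. f g * mat_trace (\<sigma> g)) = 0"
    and x: "x \<in> carrier G"
  shows "f x = 0"
proof (rule ccontr)
  assume nz: "f x \<noteq> 0"
  define N where "N = card (carrier G)"
  obtain e where e: "bij_betw e {..<N} (carrier G)"
    using ex_bij_betw_nat_finite[OF fin] unfolding N_def lessThan_atLeast0 by blast
  have ec [simp]: "e i \<in> carrier G" if "i < N" for i using e that by (auto dest: bij_betwE)
  have einj: "e i = e j \<longleftrightarrow> i = j" if "i < N" "j < N" for i j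
    using e that by (auto simp: bij_betw_def inj_on_def)
  define d where "d = inv_into {..<N} e"
  have dN: "d g < N" and ed: "e (d g) = g" if "g \<in> carrier G" for g
    using e that unfolding d_def
    by (metis bij_betw_def inv_into_into lessThan_iff, metis bij_betw_inv_into_right)
  have eq_d: "e i = g \<longleftrightarrow> i = d g" if "i < N" "g \<in> carrier G" for i g
    using that dN ed einj by metis
  \<comment> \<open>The left regular representation as permutation matrices, with the group elements
    listed by \<open>e\<close> as basis. Multiplication by \<open>R g\<close> therefore permutes
    rows or columns, which the next facts express through the inverse listing
    \<open>d\<close>.\<close>
  define R where "R g = mat N N (\<lambda>(i, j). if e i = g \<otimes> e j then 1 else 0 :: complex)" for g
  have R: "R g \<in> carrier_mat N N" for g by (simp add: R_def)
  have R_left: "(R g * A) $$ (i, j) = A $$ (d (inv g \<otimes> e i), j)"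
    if g: "g \<in> carrier G" and A: "A \<in> carrier_mat N k" and ij: "i < N" "j < k" for g A i j k
  proof -
    have "(R g * A) $$ (i, j) = (\<Sum>l<N. (if e i = g \<otimes> e l then 1 else 0) * A $$ (l, j))"
      using A ij by (simp add: R_def scalar_prod_def lessThan_atLeast0)
    also have "\<dots> = (\<Sum>l<N. if l = d (inv g \<otimes> e i) then A $$ (l, j) else 0)"
    proof (rule sum.cong)
      fix l assume "l \<in> {..<N}"
      then have "e i = g \<otimes> e l \<longleftrightarrow> l = d (inv g \<otimes> e i)"
        using g ij eq_d[of l "inv g \<otimes> e i"] inv_solve_left[of "e l" g "e i"] by auto
      then show "(if e i = g \<otimes> e l then 1 else 0) * A $$ (l, j) = (if l = d (inv g \<otimes> e i) then A $$ (l, j) else 0)"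
        by simp
    qed simp
    finally show ?thesis using dN g ij by simp
  qed
  have R_right: "(A * R g) $$ (i, j) = A $$ (i, d (g \<otimes> e j))"
    if g: "g \<in> carrier G" and A: "A \<in> carrier_mat k N" and ij: "i < k" "j < N" for g A i j k
  proof -
    have "(A * R g) $$ (i, j) = (\<Sum>l<N. A $$ (i, l) * (if e l = g \<otimes> e j then 1 else 0))"
      using A ij by (simp add: R_def scalar_prod_def lessThan_atLeast0)
    also have "\<dots> = (\<Sum>l<N. if l = d (g \<otimes> e j) then A $$ (i, l) else 0)"
      using g ij by (intro sum.cong) (auto simp: eq_d)
    finally show ?thesis using dN g ij by simp
  qed
  have "is_representation G N R"
    unfolding is_representation_iff
  proof (intro conjI ballI)
    fix g h assume gh: "g \<in> carrier G" "h \<in> carrier G"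
    show "R (g \<otimes> h) = R g * R h"
    proof (rule eq_matI)
      fix i j assume "i < dim_row (R g * R h)" "j < dim_col (R g * R h)"
      then have ij: "i < N" "j < N" by (auto simp: R_def)
      have "(R g * R h) $$ (i, j) = R g $$ (i, d (h \<otimes> e j))" by (rule R_right[OF gh(2) R ij])
      also have "\<dots> = R (g \<otimes> h) $$ (i, j)"
        using gh ij dN ed by (simp add: R_def m_assoc)
      finally show "R (g \<otimes> h) $$ (i, j) = (R g * R h) $$ (i, j)" ..
    qed (simp_all add: R_def)
  next
    show "R \<one> = 1\<^sub>m N" by (intro eq_matI) (auto simp: R_def einj)
  qed (simp add: R)
  then interpret R: representation G N R by unfold_locales
  \<comment> \<open>The only g with g e(j) = e(i) is e(i) e(j)^-1, so this is the (i, j) entry of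
    the sum of the matrices f(g) \<open>R g\<close>.\<close>
  define F where "F = mat N N (\<lambda>(i, j). f (e i \<otimes> inv (e j)))"
  define F' where "F' = mat N N (\<lambda>(i, j). cnj (F $$ (j, i)))"
  have F: "F \<in> carrier_mat N N" and F': "F' \<in> carrier_mat N N" by (auto simp: F_def F'_def)
  have F_sum: "F = sum_mats N N (\<lambda>g. f g \<cdot>\<^sub>m R g) (carrier G)"
  proof (rule eq_matI)
    fix i j assume "i < dim_row (sum_mats N N (\<lambda>g. f g \<cdot>\<^sub>m R g) (carrier G))"
      "j < dim_col (sum_mats N N (\<lambda>g. f g \<cdot>\<^sub>m R g) (carrier G))"
    then have ij: "i < N" "j < N" by (auto simp: sum_mats_def)
    have "sum_mats N N (\<lambda>g. f g \<cdot>\<^sub>m R g) (carrier G) $$ (i, j)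
      = (\<Sum>g\<in>carrier G. f g * (if e i = g \<otimes> e j then 1 else 0))"
      using ij by (simp add: sum_mats_def R_def)
    also have "\<dots> = (\<Sum>g\<in>carrier G. if g = e i \<otimes> inv (e j) then f g else 0)"
    proof (rule sum.cong)
      fix g assume "g \<in> carrier G"
      then have "e i = g \<otimes> e j \<longleftrightarrow> g = e i \<otimes> inv (e j)"
        using ij inv_solve_right[of g "e i" "e j"] by auto
      then show "f g * (if e i = g \<otimes> e j then 1 else 0) = (if g = e i \<otimes> inv (e j) then f g else 0)" by simp
    qed simp
    also have "\<dots> = F $$ (i, j)" using ij fin by (simp add: F_def)
    finally show "F $$ (i, j) = sum_mats N N (\<lambda>g. f g \<cdot>\<^sub>m R g) (carrier G) $$ (i, j)" ..
  qed (simp_all add: sum_mats_def F_def)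
  have comm: "R g * F' = F' * R g" if g: "g \<in> carrier G" for g
  proof (rule eq_matI)
    fix i j assume "i < dim_row (F' * R g)" "j < dim_col (F' * R g)"
    then have ij: "i < N" "j < N" by (auto simp: R_def F'_def)
    have "e j \<otimes> inv (inv g \<otimes> e i) = e j \<otimes> (inv (e i) \<otimes> g)"
      using g ij by (simp add: inv_mult_group)
    also have "f \<dots> = f ((e j \<otimes> inv (e i)) \<otimes> g)" using g ij by (simp add: m_assoc)
    also have "\<dots> = f (g \<otimes> (e j \<otimes> inv (e i)))" using g ij by (intro f) auto
    also have "g \<otimes> (e j \<otimes> inv (e i)) = (g \<otimes> e j) \<otimes> inv (e i)" using g ij by (simp add: m_assoc)
    finally have *: "f (e j \<otimes> inv (inv g \<otimes> e i)) = f ((g \<otimes> e j) \<otimes> inv (e i))" .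
    have "(R g * F') $$ (i, j) = F' $$ (d (inv g \<otimes> e i), j)" by (rule R_left[OF g F' ij])
    also have "\<dots> = cnj (f (e j \<otimes> inv (inv g \<otimes> e i)))"
      using g ij dN ed by (simp add: F'_def F_def)
    also have "\<dots> = F' $$ (i, d (g \<otimes> e j))"
      unfolding * using g ij dN ed by (simp add: F'_def F_def)
    also have "\<dots> = (F' * R g) $$ (i, j)" by (rule R_right[OF g F' ij, symmetric])
    finally show "(R g * F') $$ (i, j) = (F' * R g) $$ (i, j)" .
  qed (simp_all add: R_def F'_def)
  have sub: "VectorSpace.subspace class_ring (mat_range F') (module_vec TYPE(complex) N)"
    unfolding subspace_vec_iff
  proof (intro conjI ballI allI)
    show "mat_range F' \<subseteq> carrier_vec N" using F' by (auto simp: mat_range_def)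
    have "F' *\<^sub>v 0\<^sub>v N = 0\<^sub>v N" using F' by auto
    then show "0\<^sub>v N \<in> mat_range F'" using F' unfolding mat_range_def
      by (metis carrier_matD(2) image_eqI zero_carrier_vec)
    fix v w assume "v \<in> mat_range F'" "w \<in> mat_range F'"
    then obtain a b where ab: "a \<in> carrier_vec N" "b \<in> carrier_vec N" "v = F' *\<^sub>v a" "w = F' *\<^sub>v b"
      using F' by (auto simp: mat_range_def)
    then have "v + w = F' *\<^sub>v (a + b)" using F' by (simp add: mult_add_distrib_mat_vec)
    then show "v + w \<in> mat_range F'" using ab F' by (auto simp: mat_range_def)
  next
    fix c v assume "v \<in> mat_range F'"
    then obtain a where a: "a \<in> carrier_vec N" "v = F' *\<^sub>v a" using F' by (auto simp: mat_range_def)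
    then have "c \<cdot>\<^sub>v v = F' *\<^sub>v (c \<cdot>\<^sub>v a)" using mult_mat_vec[OF F'] by simp
    then show "c \<cdot>\<^sub>v v \<in> mat_range F'" using a F' by (auto simp: mat_range_def)
  qed
  have invar: "R g *\<^sub>v w \<in> mat_range F'" if g: "g \<in> carrier G" and w: "w \<in> mat_range F'" for g w
  proof -
    obtain a where a: "a \<in> carrier_vec N" "w = F' *\<^sub>v a" using F' w by (auto simp: mat_range_def)
    then have "R g *\<^sub>v w = F' *\<^sub>v (R g *\<^sub>v a)"
      using assoc_mult_mat_vec[OF R[of g] F' a(1)] assoc_mult_mat_vec[OF F' R[of g] a(1)] comm[OF g]
      by (metis (no_types))
    moreover have "R g *\<^sub>v a \<in> carrier_vec (dim_col F')"
      using F' mult_mat_vec_carrier[OF R a(1)] by simp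
    ultimately show ?thesis unfolding mat_range_def by blast
  qed
  have ne: "mat_range F' \<noteq> {0\<^sub>v N}"
  proof
    assume z: "mat_range F' = {0\<^sub>v N}"
    \<comment> \<open>The entry of \<open>F'\<close> in the row of the identity and the column of x
      is the conjugate of f(x).\<close>
    have i: "d \<one> < N" "d x < N" using dN x by auto
    have "F' *\<^sub>v unit_vec N (d x) \<in> mat_range F'" using F' by (auto simp: mat_range_def)
    then have "F' *\<^sub>v unit_vec N (d x) = 0\<^sub>v N" using z by blast
    then have "col F' (d x) = 0\<^sub>v N" unfolding mult_mat_vec_unit[OF F' i(2)] .
    then have "col F' (d x) $ d \<one> = 0" using i by simp
    moreover have "col F' (d x) $ d \<one> = cnj (f (x \<otimes> inv \<one>))"
      using i ed[OF x] ed[OF one_closed] by (simp add: F'_def F_def)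
    ultimately have "f (x \<otimes> inv \<one>) = 0" by simp
    then show False using nz x by simp
  qed
  obtain m B \<sigma> where \<sigma>: "is_irreducible_representation G m \<sigma>" and B: "B \<in> carrier_mat N m"
    "injective_mat B" "mat_range B \<subseteq> mat_range F'" and RB: "\<And>g. g \<in> carrier G \<Longrightarrow> R g * B = B * \<sigma> g"
    by (rule R.irreducible_subrepresentation[OF sub ne invar], assumption+, rule that)
  interpret S: irreducible_representation G m \<sigma>
    using \<sigma> by unfold_locales (auto simp: is_irreducible_representation_def)
  have "\<exists>c. sum_mats m m (\<lambda>g. f g \<cdot>\<^sub>m \<sigma> g) (carrier G) = c \<cdot>\<^sub>m 1\<^sub>m m \<and>
    of_nat m * c = (\<Sum>g\<in>carrier G. f g * mat_trace (\<sigma> g))"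
  proof (rule S.class_function_sum_scalar)
    show "f (g \<otimes> h) = f (h \<otimes> g)" if "g \<in> carrier G" "h \<in> carrier G" for g h
      using that by (rule f)
  qed (intro exI conjI)
  then obtain c where c: "sum_mats m m (\<lambda>g. f g \<cdot>\<^sub>m \<sigma> g) (carrier G) = c \<cdot>\<^sub>m 1\<^sub>m m"
    "of_nat m * c = (\<Sum>g\<in>carrier G. f g * mat_trace (\<sigma> g))" by (elim exE conjE)
  then have c0: "c = 0" using orth[OF \<sigma>] S.degree_pos by simp
  \<comment> \<open>Intertwining with \<open>B\<close> turns the action of \<open>F\<close> into the
    sum of the f(g) \<open>\<sigma> g\<close>, a scalar matrix whose scalar is 0 by
    orthogonality.\<close>
  have "F * B = sum_mats N m (\<lambda>g. (f g \<cdot>\<^sub>m R g) * B) (carrier G)"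
    unfolding F_sum by (rule sum_mats_mult[OF B(1)]) (simp add: R)
  also have "\<dots> = sum_mats N m (\<lambda>g. B * (f g \<cdot>\<^sub>m \<sigma> g)) (carrier G)"
  proof (rule sum_mats_cong)
    fix g assume g: "g \<in> carrier G"
    show "(f g \<cdot>\<^sub>m R g) * B = B * (f g \<cdot>\<^sub>m \<sigma> g)"
      using mult_smult_assoc_mat[OF R B(1)] mult_smult_distrib[OF B(1) S.rep_carrier[OF g]] RB[OF g] by simp
  qed
  also have "\<dots> = B * sum_mats m m (\<lambda>g. f g \<cdot>\<^sub>m \<sigma> g) (carrier G)"
    by (rule mult_sum_mats[OF B(1), symmetric]) simp
  also have "\<dots> = 0\<^sub>m N m" unfolding c(1) c0 using B by (intro eq_matI) auto
  finally have FB: "F * B = 0\<^sub>m N m" .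
  \<comment> \<open>Any nonzero vector in the range of \<open>B\<close> would do. As w = F' u and F
    w = 0, the adjoint relation gives <w, w> = <u, F w> = 0, against the injectivity of
    \<open>B\<close>.\<close>
  define w where "w = B *\<^sub>v unit_vec m 0"
  have w: "w \<in> carrier_vec N" using B by (simp add: w_def)
  have "w \<in> mat_range B" using B by (auto simp: w_def mat_range_def)
  then obtain u where u: "u \<in> carrier_vec N" "w = F' *\<^sub>v u" using B F' by (auto simp: mat_range_def)
  have "F *\<^sub>v w = (F * B) *\<^sub>v unit_vec m 0" unfolding w_def
    by (rule assoc_mult_mat_vec[OF F B(1), symmetric]) simp
  also have "\<dots> = 0\<^sub>v N" unfolding FB by (intro eq_vecI) auto
  finally have Fw: "F *\<^sub>v w = 0\<^sub>v N" .
  have F'': "mat N N (\<lambda>(i, j). cnj (F' $$ (j, i))) = F"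
    using F by (intro eq_matI) (auto simp: F'_def)
  have "w \<bullet>c w = u \<bullet>c (F *\<^sub>v w)"
    using cscalar_prod_mult_mat_vec[OF F' u(1) w] u(2) unfolding F'' by simp
  also have "\<dots> = 0" unfolding Fw using u by simp
  finally have "w = 0\<^sub>v N" using w by simp
  then have "unit_vec m 0 = (0\<^sub>v m :: complex vec)"
    using injective_matD[OF B(2,1)] unfolding w_def by simp
  then show False using S.degree_pos by simp
qed

end

text \<open>Entrywise conjugation of vectors is a semilinear involution; it carries invariant
  subspaces of the conjugate representation to invariant subspaces of \<rho>.\<close>

lemma (in irreducible_representation) conjugate_irreducible:
  "is_irreducible_representation G n (\<lambda>g. map_mat cnj (\<rho> g))"
proof -
  interpret cnj: semiring_hom cnj by unfold_locales auto
  have "is_representation G n (\<lambda>g. map_mat cnj (\<rho> g))"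
    unfolding is_representation_iff
    using rep_mult cnj.mat_hom_mult[OF rep_carrier rep_carrier] cnj.mat_hom_one by auto
  moreover have "W = {0\<^sub>v n} \<or> W = carrier_vec n"
    if W: "VectorSpace.subspace class_ring W (module_vec TYPE(complex) n)"
      and inv: "\<forall>g\<in>carrier G. \<forall>w\<in>W. map_mat cnj (\<rho> g) *\<^sub>v w \<in> W" for W
  proof -
    have W': "W \<subseteq> carrier_vec n" "0\<^sub>v n \<in> W" "\<And>v w. v \<in> W \<Longrightarrow> w \<in> W \<Longrightarrow> v + w \<in> W"
      "\<And>c v. v \<in> W \<Longrightarrow> c \<cdot>\<^sub>v v \<in> W"
      using W unfolding subspace_vec_iff by blast+
    have cc: "map_vec cnj (map_vec cnj v) = v" for v by auto
    define U where "U = map_vec cnj ` W"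
    have U_iff: "v \<in> U \<longleftrightarrow> map_vec cnj v \<in> W" for v
      unfolding U_def using cc by (metis image_iff)
    have "VectorSpace.subspace class_ring U (module_vec TYPE(complex) n)"
      unfolding subspace_vec_iff
    proof (intro conjI ballI allI)
      show Uc: "U \<subseteq> carrier_vec n" using W'(1) by (auto simp: U_def)
      show "0\<^sub>v n \<in> U" using W'(2) by (simp add: U_iff cnj.vec_hom_zero)
      show "v + w \<in> U" if "v \<in> U" "w \<in> U" for v w
      proof -
        have "map_vec cnj (v + w) = map_vec cnj v + map_vec cnj w"
          using subsetD[OF Uc that(1)] subsetD[OF Uc that(2)] by (intro eq_vecI) auto
        then show ?thesis using that W'(3) by (simp add: U_iff)
      qed
      show "c \<cdot>\<^sub>v v \<in> U" if "v \<in> U" for c v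
        using that W'(4) by (simp add: U_iff cnj.vec_hom_smult)
    qed
    moreover have "\<rho> g *\<^sub>v w \<in> U" if g: "g \<in> carrier G" and w: "w \<in> U" for g w
    proof -
      have "w \<in> carrier_vec n" using w W'(1) by (auto simp: U_def)
      then have "map_vec cnj (\<rho> g *\<^sub>v w) = map_mat cnj (\<rho> g) *\<^sub>v map_vec cnj w"
        by (rule cnj.mult_mat_vec_hom[OF rep_carrier[OF g]])
      then show ?thesis using inv g w unfolding U_iff by simp
    qed
    ultimately have "U = {0\<^sub>v n} \<or> U = carrier_vec n"
      using irr unfolding is_irreducible_representation_def by blast
    then show ?thesis
    proof
      assume U: "U = {0\<^sub>v n}"
      have "w = 0\<^sub>v n" if "w \<in> W" for w
      proof -
        have "map_vec cnj w = 0\<^sub>v n" using that U by (auto simp: U_def)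
        then show ?thesis using cc cnj.vec_hom_zero by metis
      qed
      then show ?thesis using W'(2) by blast
    next
      assume U: "U = carrier_vec n"
      have "w \<in> W" if "w \<in> carrier_vec n" for w
      proof -
        have "map_vec cnj w \<in> U" using that U by simp
        then show ?thesis by (simp add: U_iff cc)
      qed
      then show ?thesis using W'(1) by blast
    qed
  qed
  ultimately show ?thesis using degree_pos by (auto simp: is_irreducible_representation_def)
qed

section \<open>Groups of prime power order\<close>

context group
begin

text \<open>The class equation inside \<open>K\<close>. If the identity were the only central
  element of \<open>K\<close>, every other conjugacy class in \<open>K\<close> would have size
  divisible by p, so |K| would be 1 modulo p, although |K| is a power of p greater than 1.\<close>

lemma prime_power_order_normal_meets_center:
  fixes p k :: nat
  assumes p: "prime p" and card: "card (carrier G) = p ^ k"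
    and K: "K \<lhd> G" "K \<noteq> {\<one>}"
  obtains z where "z \<in> K" "z \<noteq> \<one>" "\<And>g. g \<in> carrier G \<Longrightarrow> z \<otimes> g = g \<otimes> z"
proof (rule ccontr)
  assume "\<not> thesis"
  then have nc: "\<And>z. z \<in> K \<Longrightarrow> (\<And>g. g \<in> carrier G \<Longrightarrow> z \<otimes> g = g \<otimes> z) \<Longrightarrow> z = \<one>"
    using that by blast
  have fin: "finite (carrier G)" using card p by (metis card.infinite power_not_zero prime_gt_0_nat less_irrefl)
  interpret K: normal K G by (rule K)
  define \<phi> where "\<phi> = (\<lambda>g. \<lambda>h\<in>carrier G. g \<otimes> h \<otimes> inv g)"
  interpret A: group_action G "carrier G" \<phi>
    unfolding \<phi>_def by (rule action_by_conjugation)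
  define Orb where "Orb = orbits G (carrier G) \<phi>"
  \<comment> \<open>Counts the elements of \<open>K\<close> in an orbit. The sum then runs over all
    orbits of the conjugation action on G, and classes outside \<open>K\<close> have weight
    0.\<close>
  define w where "w orb = (\<Sum>x\<in>orb. of_bool (x \<in> K) :: nat)" for orb
  have orbit: "orbit G \<phi> x = {g \<otimes> x \<otimes> inv g | g. g \<in> carrier G}" if "x \<in> carrier G" for x
    using that by (auto simp: orbit_def \<phi>_def)
  have "orbit G \<phi> \<one> = {\<one>}" by (auto simp: orbit intro!: exI[of _ \<one>])
  then have one: "{\<one>} \<in> Orb" unfolding Orb_def orbits_def by force
  have finO: "finite Orb" unfolding Orb_def orbits_def using fin by simp
  have "p dvd w orb" if orb: "orb \<in> Orb - {{\<one>}}" for orb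
  proof -
    obtain x where x: "x \<in> carrier G" "orb = orbit G \<phi> x" using orb by (auto simp: Orb_def orbits_def)
    show ?thesis
    proof (cases "x \<in> K")
      case True
      have "orb \<subseteq> K" using K.inv_op_closed2 True by (auto simp: x orbit)
      then have "w orb = (\<Sum>x\<in>orb. 1)" unfolding w_def by (intro sum.cong) auto
      then have w: "w orb = card orb" by simp
      have "card orb dvd p ^ k"
        using A.orbit_stabilizer_theorem[OF x(1)] card unfolding x(2) Coset.order_def by (metis dvd_triv_left)
      then obtain i where i: "card orb = p ^ i" using divides_primepow_nat[OF p] by blast
      have "i \<noteq> 0"
      proof
        assume "i = 0"
        then have "card orb = 1" using i by simp
        then obtain y where y: "orb = {y}" by (auto simp: card_1_singleton_iff)
        have "\<one> \<otimes> x \<otimes> inv \<one> \<in> orb" unfolding x(2) orbit[OF x(1)] by blast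
        then have "y = x" using y x by simp
        have "x \<otimes> g = g \<otimes> x" if g: "g \<in> carrier G" for g
        proof -
          have "g \<otimes> x \<otimes> inv g \<in> orb" unfolding x(2) orbit[OF x(1)] using g by blast
          then have "g \<otimes> x \<otimes> inv g = x" using y \<open>y = x\<close> by simp
          then show ?thesis using g x by (metis inv_solve_right m_closed)
        qed
        then have "x = \<one>" using nc True by blast
        then show False using orb y \<open>y = x\<close> by simp
      qed
      then show ?thesis using w i by simp
    next
      case False
      have "g \<otimes> x \<otimes> inv g \<notin> K" if g: "g \<in> carrier G" for g
      proof
        assume "g \<otimes> x \<otimes> inv g \<in> K"
        then have "inv g \<otimes> (g \<otimes> x \<otimes> inv g) \<otimes> g \<in> K" using K.inv_op_closed1[OF g] by blast
        also have "inv g \<otimes> (g \<otimes> x \<otimes> inv g) \<otimes> g = (inv g \<otimes> g) \<otimes> x \<otimes> (inv g \<otimes> g)"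
          using g x(1) by (simp only: m_assoc m_closed inv_closed)
        also have "\<dots> = x" using g x by simp
        finally show False using False by simp
      qed
      then have "w orb = 0" unfolding w_def x(2) orbit[OF x(1)] by (intro sum.neutral) auto
      then show ?thesis by simp
    qed
  qed
  then have dvd: "p dvd (\<Sum>orb\<in>Orb - {{\<one>}}. w orb)" by (rule dvd_sum)
  have "card K = (\<Sum>x\<in>carrier G. of_bool (x \<in> K))"
    using fin K.subset by (simp add: Int_absorb1)
  also have "\<dots> = (\<Sum>orb\<in>Orb. w orb)"
    unfolding w_def Orb_def by (rule A.disjoint_sum[OF fin, symmetric])
  also have "\<dots> = w {\<one>} + (\<Sum>orb\<in>Orb - {{\<one>}}. w orb)" by (rule sum.remove[OF finO one])
  also have "w {\<one>} = 1" by (simp add: w_def)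
  finally have cK: "card K = 1 + (\<Sum>orb\<in>Orb - {{\<one>}}. w orb)" .
  have "card K dvd p ^ k" using lagrange[OF K.subgroup_axioms] card unfolding Coset.order_def by (metis dvd_triv_right)
  then obtain i where i: "card K = p ^ i" using divides_primepow_nat[OF p] by blast
  have "i \<noteq> 0"
  proof
    assume "i = 0"
    then obtain y where "K = {y}" using i by (auto simp: card_1_singleton_iff)
    then have "K = {\<one>}" using K.one_closed by auto
    then show False using K(2) by contradiction
  qed
  then have "p dvd card K" using i by simp
  then have "p dvd 1" unfolding cK using dvd by (simp only: dvd_add_left_iff)
  then show False using prime_gt_1_nat[OF p] by (simp only: nat_dvd_1_iff_1)
qed

text \<open>The previous lemma applied to the image of \<open>K\<close> in G / N, with centrality in
  the quotient written out by a factor from \<open>N\<close>.\<close>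

lemma prime_power_order_normal_meets_center_mod:
  fixes p k :: nat
  assumes p: "prime p" and card: "card (carrier G) = p ^ k"
    and N: "N \<lhd> G" and K: "K \<lhd> G" and NK: "N \<subset> K"
  obtains z where "z \<in> K" "z \<notin> N" "\<And>g. g \<in> carrier G \<Longrightarrow> \<exists>m\<in>N. z \<otimes> g = m \<otimes> (g \<otimes> z)"
proof -
  interpret N: normal N G by (rule N)
  interpret K: normal K G by (rule K)
  interpret Q: group "G Mod N" by (rule N.factorgroup_is_group)
  have "card (carrier (G Mod N)) dvd p ^ k"
    using lagrange[OF N.subgroup_axioms] unfolding Coset.order_def card FactGroup_def
    by (metis dvd_triv_left partial_object.select_convs(1))
  then obtain i where i: "card (carrier (G Mod N)) = p ^ i" using divides_primepow_nat[OF p] by blast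
  have hom: "(\<lambda>x. N #> x) \<in> hom G (G Mod N)" by (rule N.r_coset_hom_Mod)
  have surj: "(\<lambda>x. N #> x) ` carrier G = carrier (G Mod N)" by (simp add: carrier_FactGroup)
  have gh: "group_hom G (G Mod N) (\<lambda>x. N #> x)"
    by (rule group_hom.intro[OF is_group N.factorgroup_is_group group_hom_axioms.intro[OF hom]])
  have norm: "(\<lambda>x. N #> x) ` K \<lhd> (G Mod N)"
    using K.surj_hom_normal_subgroup[OF gh surj] by simp
  obtain x where x: "x \<in> K" "x \<notin> N" using NK by auto
  have self: "y \<in> N #> y" if "y \<in> carrier G" for y by (rule rcos_self[OF that N.subgroup_axioms])
  have "N #> x \<noteq> N" using x self K.subset by blast
  then have "(\<lambda>x. N #> x) ` K \<noteq> {\<one>\<^bsub>G Mod N\<^esub>}" using x by auto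
  from Q.prime_power_order_normal_meets_center[OF p i norm this]
  obtain Z where Z: "Z \<in> (\<lambda>x. N #> x) ` K" "Z \<noteq> N"
    and c: "\<And>g. g \<in> carrier (G Mod N) \<Longrightarrow> Z <#> g = g <#> Z" by auto
  then obtain z where z: "z \<in> K" "Z = N #> z" by auto
  have zc: "z \<in> carrier G" using z K.subset by auto
  show thesis
  proof (rule that[OF z(1)])
    show "z \<notin> N" using Z(2) z(2) coset_join2[OF zc N.subgroup_axioms] by blast
    fix g assume g: "g \<in> carrier G"
    then have "Z <#> (N #> g) = (N #> g) <#> Z" by (intro c) (auto simp: carrier_FactGroup)
    then have "N #> (z \<otimes> g) = N #> (g \<otimes> z)" using g zc by (simp add: z(2) N.rcos_sum)
    then have "z \<otimes> g \<in> N #> (g \<otimes> z)" using self[of "z \<otimes> g"] g zc by simp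
    then show "\<exists>m\<in>N. z \<otimes> g = m \<otimes> (g \<otimes> z)" by (auto simp: r_coset_def)
  qed
qed

end

section \<open>Characters with the CM property\<close>

lemma mat_trace_map_cnj:
  "A \<in> carrier_mat n n \<Longrightarrow> mat_trace (map_mat cnj A) = cnj (mat_trace A)"
  by (auto simp: mat_trace_def)

lemma smult_one_mat_cancel:
  assumes "a \<cdot>\<^sub>m 1\<^sub>m n = (b :: 'c :: semiring_1) \<cdot>\<^sub>m 1\<^sub>m n" "n > 0"
  shows "a = b"
proof -
  have "(a \<cdot>\<^sub>m 1\<^sub>m n) $$ (0, 0) = (b \<cdot>\<^sub>m 1\<^sub>m n) $$ (0, 0)" using assms(1) by simp
  then show ?thesis using assms(2) by simp
qed

lemma Rats_complex_norm:
  assumes "z \<in> \<rat>" "cmod z = r"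
  shows "z = of_real r \<or> z = - of_real r"
proof -
  obtain q where "z = of_rat q" using assms(1) by (auto elim: Rats_cases)
  moreover have "complex_of_rat q = of_real (of_rat q)" by (cases q) (simp add: of_rat_rat)
  ultimately have "z = of_real (of_rat q)" by simp
  then show ?thesis using assms(2) by (auto simp: abs_if)
qed

locale finite_irreducible_representation = irreducible_representation +
  assumes fin: "finite (carrier G)"
begin

abbreviation \<chi> where "\<chi> \<equiv> character_of G \<rho>"

lemma character_in_Irr: "\<chi> \<in> Irr G"
  unfolding Irr_def using irr by blast

lemma mem_center_iff: "g \<in> char_center G \<chi> \<longleftrightarrow> g \<in> carrier G \<and> (\<exists>c. \<rho> g = c \<cdot>\<^sub>m 1\<^sub>m n)"
  by (simp add: char_center_eq[OF fin])

lemma mem_kernel_iff: "g \<in> char_kernel G \<chi> \<longleftrightarrow> g \<in> carrier G \<and> \<rho> g = 1\<^sub>m n"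
  by (simp add: char_kernel_eq[OF fin])

text \<open>Schur's lemma removes the scalars from the description: g lies in Z(\<chi>) exactly if
  its image in G / ker \<chi> is central.\<close>

lemma mem_center_iff_commute:
  assumes g: "g \<in> carrier G"
  shows "g \<in> char_center G \<chi> \<longleftrightarrow> (\<forall>h\<in>carrier G. \<rho> (g \<otimes> h) = \<rho> (h \<otimes> g))"
proof
  assume "g \<in> char_center G \<chi>"
  then obtain c where c: "\<rho> g = c \<cdot>\<^sub>m 1\<^sub>m n" by (auto simp: mem_center_iff)
  show "\<forall>h\<in>carrier G. \<rho> (g \<otimes> h) = \<rho> (h \<otimes> g)"
  proof
    fix h assume h: "h \<in> carrier G"
    then show "\<rho> (g \<otimes> h) = \<rho> (h \<otimes> g)"
      unfolding rep_mult[OF g h] rep_mult[OF h g] c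
      by (simp add: mult_smult_distrib[OF rep_carrier one_carrier_mat]
          mult_smult_assoc_mat[OF one_carrier_mat rep_carrier]
          left_mult_one_mat[OF rep_carrier] right_mult_one_mat[OF rep_carrier])
  qed
next
  assume a: "\<forall>h\<in>carrier G. \<rho> (g \<otimes> h) = \<rho> (h \<otimes> g)"
  have comm: "\<rho> g * \<rho> h = \<rho> h * \<rho> g" if h: "h \<in> carrier G" for h
    using a[rule_format, OF h] by (simp only: rep_mult[OF g h] rep_mult[OF h g])
  obtain c where "\<rho> g = c \<cdot>\<^sub>m 1\<^sub>m n"
    by (rule schur_scalar[OF rep_carrier[OF g] comm])
  then show "g \<in> char_center G \<chi>" using g by (auto simp: mem_center_iff)
qed

lemma mem_kernel_quotient_iff:
  assumes g: "g \<in> carrier G" and h: "h \<in> carrier G"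
  shows "inv h \<otimes> g \<in> char_kernel G \<chi> \<longleftrightarrow> \<rho> g = \<rho> h"
proof
  assume "inv h \<otimes> g \<in> char_kernel G \<chi>"
  then have "\<rho> (inv h \<otimes> g) = 1\<^sub>m n" by (simp add: mem_kernel_iff)
  then have "\<rho> (h \<otimes> (inv h \<otimes> g)) = \<rho> h * 1\<^sub>m n" using g h by (simp only: rep_mult inv_closed m_closed)
  also have "h \<otimes> (inv h \<otimes> g) = g" using g h by (simp flip: m_assoc)
  also have "\<rho> h * 1\<^sub>m n = \<rho> h" by (rule right_mult_one_mat[OF rep_carrier[OF h]])
  finally show "\<rho> g = \<rho> h" .
next
  assume "\<rho> g = \<rho> h"
  then have "\<rho> (inv h \<otimes> g) = 1\<^sub>m n" using g h by (simp only: rep_mult inv_closed rep_inv)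
  then show "inv h \<otimes> g \<in> char_kernel G \<chi>" using g h by (simp add: mem_kernel_iff)
qed

text \<open>The element tested is a commutator, and the right-hand side depends on \<chi> only
  through its kernel. Hence irreducible characters with equal kernels have equal centers.\<close>

lemma char_center_eq_kernel:
  "char_center G \<chi> = {g \<in> carrier G. \<forall>h\<in>carrier G. inv (h \<otimes> g) \<otimes> (g \<otimes> h) \<in> char_kernel G \<chi>}"
proof (rule Set.set_eqI)
  fix g
  show "g \<in> char_center G \<chi> \<longleftrightarrow> g \<in> {g \<in> carrier G. \<forall>h\<in>carrier G. inv (h \<otimes> g) \<otimes> (g \<otimes> h) \<in> char_kernel G \<chi>}"
  proof (cases "g \<in> carrier G")
    case True
    then show ?thesis
      by (simp add: mem_center_iff_commute mem_kernel_quotient_iff)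
  qed (simp add: mem_center_iff)
qed

lemma center_closed:
  assumes "g \<in> char_center G \<chi>" "h \<in> char_center G \<chi>"
  shows "g \<otimes> h \<in> char_center G \<chi>"
proof -
  obtain c d where g: "g \<in> carrier G" "\<rho> g = c \<cdot>\<^sub>m 1\<^sub>m n" and h: "h \<in> carrier G" "\<rho> h = d \<cdot>\<^sub>m 1\<^sub>m n"
    using assms by (auto simp: mem_center_iff)
  have "\<rho> (g \<otimes> h) = (d * c) \<cdot>\<^sub>m 1\<^sub>m n"
    unfolding rep_mult[OF g(1) h(1)] g(2) h(2) by (intro eq_matI) auto
  then show ?thesis using g h by (auto simp: mem_center_iff)
qed

lemma center_inv_closed:
  assumes "g \<in> char_center G \<chi>"
  shows "inv g \<in> char_center G \<chi>"
proof -
  obtain c where g: "g \<in> carrier G" "\<rho> g = c \<cdot>\<^sub>m 1\<^sub>m n" using assms by (auto simp: mem_center_iff)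
  have i: "\<rho> (inv g) \<in> carrier_mat n n" using g by simp
  have "1\<^sub>m n = c \<cdot>\<^sub>m \<rho> (inv g)"
    using rep_inv(1)[OF g(1)] mult_smult_distrib[OF i one_carrier_mat] right_mult_one_mat[OF i]
    unfolding g(2) by simp
  then have e: "(1\<^sub>m n :: complex mat) $$ (j, k) = (c \<cdot>\<^sub>m \<rho> (inv g)) $$ (j, k)" for j k by simp
  have "c \<noteq> 0" using e[of 0 0] degree_pos i by auto
  then have "\<rho> (inv g) = (1 / c) \<cdot>\<^sub>m 1\<^sub>m n"
    using e i by (intro eq_matI) (auto simp: field_simps)
  then show ?thesis using g by (auto simp: mem_center_iff)
qed

lemma center_subgroup: "subgroup (char_center G \<chi>) G"
proof (rule subgroupI)
  show "char_center G \<chi> \<subseteq> carrier G" by (auto simp: mem_center_iff)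
  have "\<one> \<in> char_center G \<chi>" by (auto simp: mem_center_iff intro!: exI[of _ 1])
  then show "char_center G \<chi> \<noteq> {}" by blast
qed (rule center_inv_closed center_closed; assumption)+

lemma kernel_normal: "char_kernel G \<chi> \<lhd> G"
  unfolding normal_inv_iff
proof (intro conjI ballI subgroupI)
  show "char_kernel G \<chi> \<subseteq> carrier G" by (auto simp: mem_kernel_iff)
  have "\<one> \<in> char_kernel G \<chi>" by (simp add: mem_kernel_iff)
  then show "char_kernel G \<chi> \<noteq> {}" by blast
next
  fix g assume "g \<in> char_kernel G \<chi>"
  then have g: "g \<in> carrier G" "\<rho> g = 1\<^sub>m n" by (auto simp: mem_kernel_iff)
  have "\<rho> (inv g) = 1\<^sub>m n"
    using rep_inv(1)[OF g(1)] right_mult_one_mat[OF rep_carrier[OF inv_closed[OF g(1)]]] g(2) by simp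
  then show "inv g \<in> char_kernel G \<chi>" using g by (simp add: mem_kernel_iff)
next
  fix g h assume "g \<in> char_kernel G \<chi>" "h \<in> char_kernel G \<chi>"
  then show "g \<otimes> h \<in> char_kernel G \<chi>" by (auto simp: mem_kernel_iff rep_mult)
next
  fix x h assume x: "x \<in> carrier G" and "h \<in> char_kernel G \<chi>"
  then have h: "h \<in> carrier G" "\<rho> h = 1\<^sub>m n" by (auto simp: mem_kernel_iff)
  have "\<rho> (x \<otimes> h \<otimes> inv x) = \<rho> x * 1\<^sub>m n * \<rho> (inv x)"
    using x h by (simp only: rep_mult m_closed inv_closed)
  also have "\<dots> = 1\<^sub>m n" by (simp only: right_mult_one_mat[OF rep_carrier[OF x]] rep_inv[OF x])
  finally show "x \<otimes> h \<otimes> inv x \<in> char_kernel G \<chi>" using x h by (simp add: mem_kernel_iff)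
qed

lemma cmod_center: "g \<in> char_center G \<chi> \<Longrightarrow> cmod (mat_trace (\<rho> g)) = n"
  unfolding char_center_def
  by (metis (mono_tags, lifting) character_eq character_one mem_Collect_eq of_real_eq_iff of_real_of_nat_eq)

lemma sum_cmod_square: "(\<Sum>g\<in>carrier G. (cmod (mat_trace (\<rho> g)))\<^sup>2) = card (carrier G)"
proof -
  have "complex_of_real (\<Sum>g\<in>carrier G. (cmod (mat_trace (\<rho> g)))\<^sup>2)
      = (\<Sum>g\<in>carrier G. mat_trace (\<rho> g) * mat_trace (\<rho> (inv g)))"
    unfolding of_real_sum
    by (intro sum.cong) (auto simp: mat_trace_inv[OF fin] complex_norm_square simp del: of_real_power)
  then show ?thesis unfolding sum_character_mult_inv[OF fin]
    by (metis of_real_eq_iff of_real_of_nat_eq)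
qed

lemma character_vanishes_off_center:
  assumes "n\<^sup>2 * card (char_center G \<chi>) = card (carrier G)"
    and g: "g \<in> carrier G" "g \<notin> char_center G \<chi>"
  shows "mat_trace (\<rho> g) = 0"
proof -
  let ?Z = "char_center G \<chi>" and ?s = "\<lambda>g. (cmod (mat_trace (\<rho> g)))\<^sup>2"
  have sub: "?Z \<subseteq> carrier G" by (auto simp: mem_center_iff)
  have "(\<Sum>g\<in>?Z. ?s g) = (\<Sum>g\<in>?Z. (real n)\<^sup>2)"
    by (intro sum.cong) (auto simp: cmod_center)
  also have "\<dots> = real (n\<^sup>2 * card ?Z)" by simp
  finally have "(\<Sum>g\<in>?Z. ?s g) = real (card (carrier G))" unfolding assms(1) .
  then have "(\<Sum>g\<in>carrier G - ?Z. ?s g) = 0"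
    using sum.subset_diff[OF sub fin, of ?s] sum_cmod_square by simp
  then have "\<forall>g\<in>carrier G - ?Z. ?s g = 0"
    using fin by (subst (asm) sum_nonneg_eq_0_iff) auto
  then show ?thesis using g by auto
qed

text \<open>Squaring and Lagrange's theorem turn the GVZ condition into an equation of natural
  numbers, free of roots and cosets.\<close>

lemma degree_eq_sqrt_index_iff:
  "\<chi> \<one> = complex_of_real (sqrt (real (card (rcosets (char_center G \<chi>)))))
    \<longleftrightarrow> n\<^sup>2 * card (char_center G \<chi>) = card (carrier G)"
proof -
  define r where "r = card (rcosets (char_center G \<chi>))"
  define z where "z = card (char_center G \<chi>)"
  have rz: "r * z = card (carrier G)"
    using lagrange[OF center_subgroup] by (simp add: r_def z_def Coset.order_def)
  have "z > 0" using rz fin one_closed by (metis card_gt_0_iff empty_iff gr0I mult_0_right)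
  have "\<chi> \<one> = complex_of_real (sqrt (real r)) \<longleftrightarrow> real n = sqrt (real r)"
    by (metis character_one of_real_eq_iff of_real_of_nat_eq)
  also have "\<dots> \<longleftrightarrow> (real n)\<^sup>2 = real r"
    by (metis of_nat_0_le_iff real_sqrt_pow2 real_sqrt_unique)
  also have "\<dots> \<longleftrightarrow> n\<^sup>2 = r" by (metis of_nat_eq_iff of_nat_power)
  also have "\<dots> \<longleftrightarrow> n\<^sup>2 * z = card (carrier G)" using \<open>z > 0\<close> by (simp flip: rz)
  finally show ?thesis by (simp add: r_def z_def)
qed

end

section \<open>Characters of rational GVZ-groups are determined by their kernels\<close>

lemma (in group) Irr_cases:
  assumes "finite (carrier G)" "\<chi> \<in> Irr G"
  obtains n \<rho> where "finite_irreducible_representation G n \<rho>" "\<chi> = character_of G \<rho>"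
proof -
  obtain n \<rho> where r: "is_irreducible_representation G n \<rho>" "\<chi> = character_of G \<rho>"
    using assms(2) by (auto simp: Irr_def)
  have "finite_irreducible_representation G n \<rho>"
    using r(1) assms(1) by unfold_locales (auto simp: is_irreducible_representation_def)
  then show thesis using that r by blast
qed

lemma (in group) GVZ_rational_imp_CM:
  assumes fin: "finite (carrier G)" and gvz: "GVZ_group G" and rat: "rational_group G"
  shows "CM_group G"
  unfolding CM_group_def
proof (intro allI impI Uniq_I)
  fix N \<chi> \<psi>
  assume "\<chi> \<in> Irr G \<and> char_kernel G \<chi> = N" "\<psi> \<in> Irr G \<and> char_kernel G \<psi> = N"
  then have \<chi>: "\<chi> \<in> Irr G" and \<psi>: "\<psi> \<in> Irr G" and ker: "char_kernel G \<chi> = char_kernel G \<psi>" by auto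
  obtain n \<rho> where \<rho>: "finite_irreducible_representation G n \<rho>" "\<chi> = character_of G \<rho>"
    by (rule Irr_cases[OF fin \<chi>])
  obtain m \<sigma> where \<sigma>: "finite_irreducible_representation G m \<sigma>" "\<psi> = character_of G \<sigma>"
    by (rule Irr_cases[OF fin \<psi>])
  interpret R: finite_irreducible_representation G n \<rho> by (rule \<rho>(1))
  interpret S: finite_irreducible_representation G m \<sigma> by (rule \<sigma>(1))
  have Z: "char_center G \<chi> = char_center G \<psi>"
    using ker unfolding \<rho>(2) \<sigma>(2) R.char_center_eq_kernel S.char_center_eq_kernel by simp
  have n: "n\<^sup>2 * card (char_center G \<chi>) = card (carrier G)"
    using gvz \<chi> R.degree_eq_sqrt_index_iff unfolding GVZ_group_def \<rho>(2) by blast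
  have m: "m\<^sup>2 * card (char_center G \<psi>) = card (carrier G)"
    using gvz \<psi> S.degree_eq_sqrt_index_iff unfolding GVZ_group_def \<sigma>(2) by blast
  have "card (carrier G) > 0" using fin by (auto simp: card_gt_0_iff)
  then have "card (char_center G \<psi>) > 0" using m by (metis gr0I mult_0_right)
  then have "n\<^sup>2 = m\<^sup>2" using n m unfolding Z by (metis mult_right_cancel less_irrefl)
  then have nm: "n = m" by (simp add: power2_eq_iff_nonneg)
  have R_tr: "\<chi> g = mat_trace (\<rho> g)" and S_tr: "\<psi> g = mat_trace (\<sigma> g)" if "g \<in> carrier G" for g
    using that by (simp_all add: \<rho>(2) \<sigma>(2) R.character_eq S.character_eq)
  have one: "\<chi> \<one> = of_nat n" "\<psi> \<one> = of_nat n" using nm by (simp_all add: \<rho>(2) \<sigma>(2))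
  have eq: "\<chi> g = \<psi> g" if g: "g \<in> carrier G" for g
  proof (cases "g \<in> char_center G \<chi>")
    case False
    then have "\<chi> g = 0" "\<psi> g = 0"
      using R.character_vanishes_off_center[OF n[unfolded \<rho>(2)] g]
        S.character_vanishes_off_center[OF m[unfolded \<sigma>(2)] g] Z R_tr[OF g] S_tr[OF g] \<rho>(2) \<sigma>(2)
      by simp_all
    then show ?thesis by simp
  next
    case True
    have "cmod (\<chi> g) = n" "cmod (\<psi> g) = n"
      using R.cmod_center[of g] S.cmod_center[of g] True Z nm R_tr[OF g] S_tr[OF g] \<rho>(2) \<sigma>(2) by simp_all
    moreover have "\<chi> g \<in> \<rat>" "\<psi> g \<in> \<rat>" using rat \<chi> \<psi> g by (auto simp: rational_group_def)
    ultimately have pm: "\<chi> g = of_nat n \<or> \<chi> g = - of_nat n" "\<psi> g = of_nat n \<or> \<psi> g = - of_nat n"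
      using Rats_complex_norm by (metis of_real_of_nat_eq)+
    \<comment> \<open>On the common center both values are n or -n, and membership in the common
      kernel decides which.\<close>
    have "g \<in> char_kernel G \<chi> \<longleftrightarrow> g \<in> char_kernel G \<psi>" using ker by simp
    then have "\<chi> g = of_nat n \<longleftrightarrow> \<psi> g = of_nat n" using g one by (simp add: char_kernel_def)
    then show ?thesis using pm by auto
  qed
  show "\<chi> = \<psi>"
  proof
    \<comment> \<open>Equality is one of functions on the whole type; outside the carrier both
      characters are \<open>undefined\<close> by restriction.\<close>
    fix g show "\<chi> g = \<psi> g"
    proof (cases "g \<in> carrier G")
      case False
      then show ?thesis by (simp add: \<rho>(2) \<sigma>(2) character_of_def)
    qed (rule eq)
  qed
qed

text \<open>Let \<open>f\<close> agree with \<open>\<chi>\<close> on \<open>Z(\<chi>)\<close> and vanish elsewhere, minus the multiple of \<open>\<chi>\<close> making it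
  orthogonal to \<open>\<chi>\<close>. An irreducible \<open>\<sigma>\<close> not orthogonal to \<open>f\<close> acts by \<open>\<epsilon>\<close> wherever \<open>\<rho>\<close> acts by
  \<open>\<epsilon> = \<plusminus>1\<close>. In a 2-group this forces \<open>ker \<sigma> = ker \<rho>\<close>, so \<open>\<sigma>\<close> affords \<open>\<chi>\<close>, a contradiction;
  hence \<open>f = 0\<close>.\<close>

context finite_irreducible_representation
begin

lemma CM_character_real:
  assumes cm: "CM_group G" and g: "g \<in> carrier G"
  shows "cnj (mat_trace (\<rho> g)) = mat_trace (\<rho> g)"
proof -
  let ?\<psi> = "character_of G (\<lambda>g. map_mat cnj (\<rho> g))"
  have \<psi>: "?\<psi> h = cnj (mat_trace (\<rho> h))" if "h \<in> carrier G" for h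
    using that by (simp add: character_of_def mat_trace_map_cnj[OF rep_carrier])
  \<comment> \<open>The degree is real, so a value and its conjugate reach it together; this is why
    conjugation preserves the kernel.\<close>
  have cnj_eq: "cnj z = of_nat n \<longleftrightarrow> z = of_nat n" for z
    by (metis complex_cnj_cnj complex_cnj_of_nat)
  have mat_trace_one: "mat_trace (1\<^sub>m n) = (of_nat n :: complex)" by (simp add: mat_trace_def)
  have "?\<psi> \<in> Irr G" unfolding Irr_def using conjugate_irreducible by blast
  moreover have "char_kernel G ?\<psi> = char_kernel G \<chi>"
    unfolding char_kernel_def by (intro Collect_cong conj_cong refl) (simp add: \<psi> character_eq mat_trace_one cnj_eq)
  ultimately have "?\<psi> = \<chi>"
    using cm kernel_normal character_in_Irr unfolding CM_group_def Uniq_def by blast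
  then show ?thesis using \<psi>[OF g] character_eq[OF g] by simp
qed

lemma CM_center_sign:
  assumes cm: "CM_group G" and g: "g \<in> char_center G \<chi>"
  obtains \<epsilon> where "\<rho> g = \<epsilon> \<cdot>\<^sub>m 1\<^sub>m n" "\<epsilon> = 1 \<or> \<epsilon> = -1" "mat_trace (\<rho> g) = of_nat n * \<epsilon>"
proof -
  obtain c where c: "g \<in> carrier G" "\<rho> g = c \<cdot>\<^sub>m 1\<^sub>m n" using g by (auto simp: mem_center_iff)
  have t: "mat_trace (\<rho> g) = of_nat n * c" by (simp add: c mat_trace_smult_one)
  have "cmod c = 1" using cmod_center[OF g] degree_pos by (simp add: t norm_mult)
  moreover have "cnj c = c" using CM_character_real[OF cm c(1)] degree_pos by (simp add: t)
  ultimately have "c * c = 1" by (metis complex_norm_square of_real_1 power_one)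
  then have "c = 1 \<or> c = -1" by (simp add: square_eq_1_iff)
  then show thesis using that c t by blast
qed

lemma CM_imp_central_type_and_rational:
  assumes cm: "CM_group G" and card: "card (carrier G) = 2 ^ k"
  shows "n\<^sup>2 * card (char_center G \<chi>) = card (carrier G)"
    and "\<forall>g\<in>carrier G. \<chi> g \<in> \<rat>"
proof -
  let ?Z = "char_center G \<chi>" and ?N = "char_kernel G \<chi>" and ?t = "\<lambda>g. mat_trace (\<rho> g)"
  \<comment> \<open>The projection coefficient onto \<chi>: the values n or -n on Z(\<chi>) give the
    restricted function the product n^2 |Z(\<chi>)| with \<chi>, and the product of \<chi> with
    itself is |G|. As \<chi> is real, these products involve no conjugates.\<close>
  define c :: complex where "c = of_nat (n\<^sup>2 * card ?Z) / of_nat (card (carrier G))"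
  define f where "f g = (if g \<in> ?Z then ?t g else 0) - c * ?t g" for g
  have card0: "card (carrier G) > 0" using card by simp
  have one_smult: "(1 :: complex) \<cdot>\<^sub>m 1\<^sub>m j = 1\<^sub>m j" for j by (intro eq_matI) auto
  have Zc: "?Z \<subseteq> carrier G" by (auto simp: mem_center_iff)
  have tt: "(\<Sum>g\<in>carrier G. ?t g * ?t g) = of_nat (card (carrier G))"
    using sum_character_mult_inv[OF fin] by (simp add: mat_trace_inv[OF fin] CM_character_real[OF cm])
  have "(\<Sum>g\<in>carrier G. (if g \<in> ?Z then ?t g else 0) * ?t g) = (\<Sum>g\<in>carrier G. if g \<in> ?Z then ?t g * ?t g else 0)"
    by (intro sum.cong) auto
  also have "\<dots> = (\<Sum>g\<in>?Z. ?t g * ?t g)"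
    using Zc by (simp add: sum.inter_restrict[OF fin, symmetric] Int_absorb1)
  also have "\<dots> = (\<Sum>g\<in>?Z. of_nat (n\<^sup>2))"
  proof (rule sum.cong[OF refl])
    fix g assume "g \<in> ?Z"
    then obtain \<epsilon> where "\<epsilon> = 1 \<or> \<epsilon> = -1" "?t g = of_nat n * \<epsilon>" by (rule CM_center_sign[OF cm])
    then show "?t g * ?t g = of_nat (n\<^sup>2)" by (auto simp: power2_eq_square)
  qed
  also have "\<dots> = c * of_nat (card (carrier G))" using card0 by (simp add: c_def)
  finally have f\<chi>: "(\<Sum>g\<in>carrier G. f g * ?t g) = 0"
    by (simp add: f_def left_diff_distrib sum_subtractf mult.assoc tt flip: sum_distrib_left)
  have tcomm: "?t (g \<otimes> h) = ?t (h \<otimes> g)" if "g \<in> carrier G" "h \<in> carrier G" for g h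
    using that mat_trace_mult_comm[OF rep_carrier rep_carrier] by (simp only: rep_mult)
  \<comment> \<open>The element h g is the conjugate of g h by h, so it acts by the same scalar;
    this makes \<open>f\<close> a class function.\<close>
  have Zcomm: "h \<otimes> g \<in> ?Z" if gh: "g \<in> carrier G" "h \<in> carrier G" and z: "g \<otimes> h \<in> ?Z" for g h
  proof -
    obtain d where d: "\<rho> (g \<otimes> h) = d \<cdot>\<^sub>m 1\<^sub>m n" using z by (auto simp: mem_center_iff)
    have "\<rho> (h \<otimes> g) = \<rho> h * \<rho> (g \<otimes> h) * \<rho> (inv h)"
    proof -
      have "h \<otimes> g = h \<otimes> (g \<otimes> h) \<otimes> inv h" using gh by (simp add: m_assoc)
      then show ?thesis using gh by (simp only: rep_mult m_closed inv_closed)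
    qed
    also have "\<rho> h * \<rho> (g \<otimes> h) = d \<cdot>\<^sub>m \<rho> h"
      unfolding d mult_smult_distrib[OF rep_carrier[OF gh(2)] one_carrier_mat]
        right_mult_one_mat[OF rep_carrier[OF gh(2)]] ..
    also have "d \<cdot>\<^sub>m \<rho> h * \<rho> (inv h) = d \<cdot>\<^sub>m 1\<^sub>m n"
      using mult_smult_assoc_mat[OF rep_carrier[OF gh(2)] rep_carrier[OF inv_closed[OF gh(2)]]]
        rep_inv(2)[OF gh(2)] by simp
    finally show ?thesis using gh by (auto simp: mem_center_iff)
  qed
  have fcomm: "f (g \<otimes> h) = f (h \<otimes> g)" if "g \<in> carrier G" "h \<in> carrier G" for g h
    using that Zcomm tcomm by (auto simp: f_def)
  \<comment> \<open>Translation by y preserves Z(\<chi>) and multiplies \<chi> by the scalar, hence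
    acts in the same way on both parts of \<open>f\<close>.\<close>
  have fsign: "f (y \<otimes> g) = \<epsilon> * f g" if y: "y \<in> carrier G" "\<rho> y = \<epsilon> \<cdot>\<^sub>m 1\<^sub>m n" and g: "g \<in> carrier G" for y \<epsilon> g
  proof -
    have yZ: "y \<in> ?Z" using y by (auto simp: mem_center_iff)
    have "y \<otimes> g \<in> ?Z \<longleftrightarrow> g \<in> ?Z"
    proof
      assume "y \<otimes> g \<in> ?Z"
      then have "inv y \<otimes> (y \<otimes> g) \<in> ?Z" by (rule center_closed[OF center_inv_closed[OF yZ]])
      then show "g \<in> ?Z" using y g by (simp flip: m_assoc)
    qed (rule center_closed[OF yZ])
    moreover have "?t (y \<otimes> g) = \<epsilon> * ?t g"
    proof -
      have "\<rho> (y \<otimes> g) = \<epsilon> \<cdot>\<^sub>m \<rho> g"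
        unfolding rep_mult[OF y(1) g] y(2) mult_smult_assoc_mat[OF one_carrier_mat rep_carrier[OF g]]
          left_mult_one_mat[OF rep_carrier[OF g]] ..
      then show ?thesis using carrier_matD[OF rep_carrier[OF g]]
        by (simp add: mat_trace_def sum_distrib_left)
    qed
    ultimately show ?thesis by (simp add: f_def algebra_simps)
  qed
  have orth: "(\<Sum>g\<in>carrier G. f g * mat_trace (\<sigma> g)) = 0" if \<sigma>: "is_irreducible_representation G m \<sigma>" for m \<sigma>
  proof (rule ccontr)
    assume nz: "(\<Sum>g\<in>carrier G. f g * mat_trace (\<sigma> g)) \<noteq> 0"
    interpret S: finite_irreducible_representation G m \<sigma>
      using \<sigma> fin by unfold_locales (auto simp: is_irreducible_representation_def)
    define X where "X = sum_mats m m (\<lambda>g. f g \<cdot>\<^sub>m \<sigma> g) (carrier G)"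
    have "\<exists>s. X = s \<cdot>\<^sub>m 1\<^sub>m m \<and> of_nat m * s = (\<Sum>g\<in>carrier G. f g * mat_trace (\<sigma> g))"
      unfolding X_def
    proof (rule S.class_function_sum_scalar)
      show "f (g \<otimes> h) = f (h \<otimes> g)" if "g \<in> carrier G" "h \<in> carrier G" for g h
        using that by (rule fcomm)
    qed (intro exI conjI)
    then obtain s where "X = s \<cdot>\<^sub>m 1\<^sub>m m" "of_nat m * s = (\<Sum>g\<in>carrier G. f g * mat_trace (\<sigma> g))"
      by (elim exE conjE)
    then have s: "X = s \<cdot>\<^sub>m 1\<^sub>m m" "s \<noteq> 0" using nz by auto
    \<comment> \<open>The translation rule for \<open>f\<close> and \<epsilon>^2 = 1 give
      \<open>\<sigma> y * X = \<epsilon> \<cdot>\<^sub>m X\<close>. Since \<open>X\<close> is a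
      nonzero scalar matrix, it can be cancelled.\<close>
    have \<sigma>sign: "\<sigma> y = \<epsilon> \<cdot>\<^sub>m 1\<^sub>m m"
      if y: "y \<in> carrier G" "\<rho> y = \<epsilon> \<cdot>\<^sub>m 1\<^sub>m n" and \<epsilon>: "\<epsilon> = 1 \<or> \<epsilon> = -1" for y \<epsilon>
    proof -
      have bij: "bij_betw (\<lambda>g. y \<otimes> g) (carrier G) (carrier G)"
        by (rule bij_betw_byWitness[where f' = "\<lambda>g. inv y \<otimes> g"])
           (use y in \<open>auto simp flip: m_assoc\<close>)
      have "\<sigma> y * X = sum_mats m m (\<lambda>g. \<sigma> y * (f g \<cdot>\<^sub>m \<sigma> g)) (carrier G)"
        unfolding X_def by (rule mult_sum_mats[OF S.rep_carrier[OF y(1)]]) simp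
      also have "\<dots> = sum_mats m m (\<lambda>g. \<epsilon> \<cdot>\<^sub>m (f (y \<otimes> g) \<cdot>\<^sub>m \<sigma> (y \<otimes> g))) (carrier G)"
      proof (rule sum_mats_cong)
        fix g assume g: "g \<in> carrier G"
        have "\<epsilon> * f (y \<otimes> g) = f g" using fsign[OF y g] \<epsilon> by auto
        then show "\<sigma> y * (f g \<cdot>\<^sub>m \<sigma> g) = \<epsilon> \<cdot>\<^sub>m (f (y \<otimes> g) \<cdot>\<^sub>m \<sigma> (y \<otimes> g))"
          unfolding mult_smult_distrib[OF S.rep_carrier[OF y(1)] S.rep_carrier[OF g]] S.rep_mult[OF y(1) g]
          by (auto simp flip: mult.assoc intro!: eq_matI)
      qed
      also have "\<dots> = sum_mats m m (\<lambda>g. \<epsilon> \<cdot>\<^sub>m (f g \<cdot>\<^sub>m \<sigma> g)) (carrier G)"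
        by (rule sum_mats_reindex[OF bij])
      also have "\<dots> = \<epsilon> \<cdot>\<^sub>m X" unfolding X_def by (rule smult_sum_mats) simp
      finally have "\<sigma> y * X = \<epsilon> \<cdot>\<^sub>m X" .
      moreover have "\<sigma> y * X = s \<cdot>\<^sub>m \<sigma> y"
        unfolding s(1) mult_smult_distrib[OF S.rep_carrier[OF y(1)] one_carrier_mat]
          right_mult_one_mat[OF S.rep_carrier[OF y(1)]] ..
      ultimately have "s \<cdot>\<^sub>m \<sigma> y = \<epsilon> \<cdot>\<^sub>m (s \<cdot>\<^sub>m 1\<^sub>m m)" using s(1) by simp
      then have e: "(s \<cdot>\<^sub>m \<sigma> y) $$ (i, j) = (\<epsilon> \<cdot>\<^sub>m (s \<cdot>\<^sub>m 1\<^sub>m m)) $$ (i, j)" for i j by simp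
      show ?thesis
      proof (rule eq_matI)
        fix i j assume "i < dim_row (\<epsilon> \<cdot>\<^sub>m 1\<^sub>m m)" "j < dim_col (\<epsilon> \<cdot>\<^sub>m 1\<^sub>m m :: complex mat)"
        then show "\<sigma> y $$ (i, j) = (\<epsilon> \<cdot>\<^sub>m 1\<^sub>m m) $$ (i, j)"
          using e[of i j] s(2) carrier_matD[OF S.rep_carrier[OF y(1)]] by auto
      qed (use carrier_matD[OF S.rep_carrier[OF y(1)]] in auto)
    qed
    have sub: "?N \<subseteq> char_kernel G (character_of G \<sigma>)"
    proof
      fix y assume "y \<in> ?N"
      then have y: "y \<in> carrier G" "\<rho> y = 1 \<cdot>\<^sub>m 1\<^sub>m n" by (simp_all add: mem_kernel_iff one_smult)
      have "\<sigma> y = 1\<^sub>m m" using \<sigma>sign[OF y] by (simp add: one_smult)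
      then show "y \<in> char_kernel G (character_of G \<sigma>)" using y(1) by (simp add: S.mem_kernel_iff)
    qed
    have "?N = char_kernel G (character_of G \<sigma>)"
    proof (rule ccontr)
      assume "?N \<noteq> char_kernel G (character_of G \<sigma>)"
      then have "?N \<subset> char_kernel G (character_of G \<sigma>)" using sub by blast
      \<comment> \<open>A kernel of \<sigma> larger than ker \<chi> would contain z outside ker
        \<chi> but central modulo it. Then z lies in Z(\<chi>) and acts by -1 under \<rho>, hence by
        -1 under \<sigma> too, although \<sigma> is trivial on z.\<close>
      then obtain z where z: "z \<in> char_kernel G (character_of G \<sigma>)" "z \<notin> ?N"
        and zg: "\<And>g. g \<in> carrier G \<Longrightarrow> \<exists>y\<in>?N. z \<otimes> g = y \<otimes> (g \<otimes> z)"
        using prime_power_order_normal_meets_center_mod[OF two_is_prime_nat card kernel_normal S.kernel_normal]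
        by blast
      have zc: "z \<in> carrier G" and \<sigma>z: "\<sigma> z = 1\<^sub>m m" using z(1) by (auto simp: S.mem_kernel_iff)
      have "z \<in> ?Z"
        unfolding mem_center_iff_commute[OF zc]
      proof
        fix g assume g: "g \<in> carrier G"
        then obtain y where y: "y \<in> ?N" "z \<otimes> g = y \<otimes> (g \<otimes> z)" using zg by blast
        then have yc: "y \<in> carrier G" "\<rho> y = 1\<^sub>m n" by (auto simp: mem_kernel_iff)
        have "\<rho> (z \<otimes> g) = \<rho> y * \<rho> (g \<otimes> z)" unfolding y(2) using g zc yc by (intro rep_mult) auto
        then show "\<rho> (z \<otimes> g) = \<rho> (g \<otimes> z)"
          unfolding yc(2) using left_mult_one_mat[OF rep_carrier[OF m_closed[OF g zc]]] by simp
      qed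
      then obtain \<epsilon> where \<epsilon>: "\<rho> z = \<epsilon> \<cdot>\<^sub>m 1\<^sub>m n" "\<epsilon> = 1 \<or> \<epsilon> = -1" by (rule CM_center_sign[OF cm])
      have "\<epsilon> \<noteq> 1" using z(2) zc \<epsilon>(1) by (auto simp: mem_kernel_iff one_smult)
      moreover have "\<epsilon> \<cdot>\<^sub>m 1\<^sub>m m = (1 :: complex) \<cdot>\<^sub>m 1\<^sub>m m" using \<sigma>sign[OF zc \<epsilon>] \<sigma>z by (simp add: one_smult)
      ultimately show False using smult_one_mat_cancel S.degree_pos by blast
    qed
    then have "character_of G \<sigma> = \<chi>"
      using cm kernel_normal character_in_Irr S.character_in_Irr unfolding CM_group_def Uniq_def by metis
    then have "mat_trace (\<sigma> g) = ?t g" if "g \<in> carrier G" for g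
      using that character_eq S.character_eq by metis
    then have "(\<Sum>g\<in>carrier G. f g * mat_trace (\<sigma> g)) = 0" using f\<chi> by simp
    then show False using nz by contradiction
  qed
  have f0: "f g = 0" if "g \<in> carrier G" for g
    by (rule class_function_eq_zero[of f, OF fin fcomm orth that])
  have "\<one> \<in> ?Z" by (rule subgroup.one_closed[OF center_subgroup])
  \<comment> \<open>At the identity f = 0 reads n - c n = 0. By the choice of \<open>c\<close>, the
    value 1 is already the degree formula.\<close>
  then have "c = 1" using f0[OF one_closed] degree_pos by (simp add: f_def mat_trace_def)
  then have "of_nat (n\<^sup>2 * card ?Z) = (of_nat (card (carrier G)) :: complex)"
    using card0 unfolding c_def by (simp add: divide_eq_1_iff)
  then show *: "n\<^sup>2 * card ?Z = card (carrier G)" by (simp only: of_nat_eq_iff)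
  show "\<forall>g\<in>carrier G. \<chi> g \<in> \<rat>"
  proof
    fix g assume g: "g \<in> carrier G"
    show "\<chi> g \<in> \<rat>"
    proof (cases "g \<in> ?Z")
      case True
      then obtain \<epsilon> where "\<epsilon> = 1 \<or> \<epsilon> = -1" "?t g = of_nat n * \<epsilon>" by (rule CM_center_sign[OF cm])
      then show ?thesis using character_eq[OF g] by auto
    next
      case False
      then show ?thesis using character_vanishes_off_center[OF * g] character_eq[OF g] by simp
    qed
  qed
qed

end

theorem corollary4p5:
  fixes G :: "('a, 'b) monoid_scheme"
  assumes "group G"
    and "finite (carrier G)"
    and "\<exists>k. card (carrier G) = 2 ^ k"
  shows "CM_group G \<longleftrightarrow> GVZ_group G \<and> rational_group G"
proof -
  interpret group G by (rule assms(1))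
  obtain k where k: "card (carrier G) = 2 ^ k" using assms(3) by blast
  show ?thesis
  proof
    assume cm: "CM_group G"
    have "\<chi> \<one>\<^bsub>G\<^esub> = complex_of_real (sqrt (real (card (rcosets\<^bsub>G\<^esub> (char_center G \<chi>)))))
        \<and> (\<forall>g\<in>carrier G. \<chi> g \<in> \<rat>)" if irr: "\<chi> \<in> Irr G" for \<chi>
    proof -
      obtain n \<rho> where R: "finite_irreducible_representation G n \<rho>" and \<chi>: "\<chi> = character_of G \<rho>"
        by (rule Irr_cases[OF assms(2) irr])
      interpret R: finite_irreducible_representation G n \<rho> by (rule R)
      show ?thesis
        using R.CM_imp_central_type_and_rational[OF cm k] R.degree_eq_sqrt_index_iff unfolding \<chi> by blast
    qed
    then show "GVZ_group G \<and> rational_group G"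
      unfolding GVZ_group_def rational_group_def by blast
  next
    assume "GVZ_group G \<and> rational_group G"
    then show "CM_group G" using GVZ_rational_imp_CM[OF assms(2)] by blast
  qed
qed

end
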